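(* Let $K$ be a field and let $n\ge 1$, $d\ge 0$, $c\ge 0$ be integers. The bounded Veronese ideal $I_{n,d,c}\subseteq K[x_1,\ldots,x_n]$ is of linear type if and only if $n=1$ or $d\leq 1$ or $d\geq nc-1$.
   Context: All rings are commutative with unit. The bounded Veronese ideal $I_{n,d,c}\subseteq K[x_1,\ldots,x_n]$ is the ideal generated by all monomials $x_1^{\alpha_1}\cdots x_n^{\alpha_n}$ with $\alpha_1+\cdots+\alpha_n=d$ and $\alpha_i\le c$ for all $i$ (it is the zero ideal if no such monomial exists). For a Noetherian ring $R$ and an ideal $I=(f_1,\ldots,f_m)\subseteq R$, let $\mathcal{R}(I)=R[f_1t,\ldots,f_mt]\subseteq R[t]$ be the Rees algebra, $T=R[y_1,\ldots,y_m]$ a polynomial ring, $\varphi:T\to\mathcal{R}(I)$ the $R$-algebra homomorphism with $\varphi(y_j)=f_jt$, and $J=\ker\varphi$. Let $L\subseteq J$ be the ideal of $T$ generated by all linear relations $\sum_{i=1}^m a_iy_i$ with $a_i\in R$ and $\sum_i a_if_i=0$. The ideal $I$ is of linear type if $J=L$, equivalently if the canonical epimorphism from the symmetric algebra $S(I)\cong T/L$ to $\mathcal{R}(I)$ is an isomorphism. *)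

theory Defs
  imports
    "HOL-Library.Poly_Mapping"
    "HOL-Library.Cardinality"
    "HOL-Computational_Algebra.Polynomial"
begin

text \<open>
  Multivariate polynomials are finitely supported maps from exponent vectors to coefficients,
  with the convolution product of \<^theory>\<open>HOL-Library.Poly_Mapping\<close>.
\<close>

type_synonym ('v, 'a) mpol = "('v \<Rightarrow>\<^sub>0 nat) \<Rightarrow>\<^sub>0 'a"

definition Const :: "'a::zero \<Rightarrow> ('v, 'a) mpol"
  where "Const a = Poly_Mapping.single 0 a"

definition Var :: "'v \<Rightarrow> ('v, 'a::zero_neq_one) mpol"
  where "Var v = Poly_Mapping.single (Poly_Mapping.single v 1) 1"

definition mpols_in :: "'v set \<Rightarrow> ('v, 'a::zero) mpol set"
  where "mpols_in V = {P. \<forall>\<alpha>\<in>Poly_Mapping.keys P. Poly_Mapping.keys \<alpha> \<subseteq> V}"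

text \<open>Coefficients are transported along \<open>h\<close>, and each variable \<open>v\<close> is replaced by \<open>g v\<close>.\<close>

definition mpol_eval :: "('a::comm_ring_1 \<Rightarrow> 'b::comm_ring_1) \<Rightarrow> ('v \<Rightarrow> 'b) \<Rightarrow> ('v, 'a) mpol \<Rightarrow> 'b"
  where "mpol_eval h g P =
    (\<Sum>\<alpha>\<in>Poly_Mapping.keys P. h (Poly_Mapping.lookup P \<alpha>) *
       (\<Prod>v\<in>Poly_Mapping.keys \<alpha>. g v ^ Poly_Mapping.lookup \<alpha> v))"

text \<open>
  Ideals are taken relative to a subring \<open>T\<close> of the ambient type, because the number of variables
  of the ring \<open>R[y\<^sub>0,\<dots>,y\<^sub>m\<^sub>-\<^sub>1]\<close> below is a term and not a type.
\<close>

definition is_ideal :: "'a::comm_ring_1 set \<Rightarrow> 'a set \<Rightarrow> bool"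
  where "is_ideal T I \<longleftrightarrow>
    I \<subseteq> T \<and> 0 \<in> I \<and> (\<forall>a\<in>I. \<forall>b\<in>I. a + b \<in> I) \<and> (\<forall>r\<in>T. \<forall>a\<in>I. r * a \<in> I)"

definition ideal_gen :: "'a::comm_ring_1 set \<Rightarrow> 'a set \<Rightarrow> 'a set"
  where "ideal_gen T S = is_ideal T hull S"

definition bounded_veronese :: "nat \<Rightarrow> nat \<Rightarrow> ('n::finite, 'k::field) mpol set"
  where "bounded_veronese d c = ideal_gen UNIV
    {Poly_Mapping.single \<alpha> 1 | \<alpha>.
       (\<Sum>i\<in>UNIV. Poly_Mapping.lookup \<alpha> i) = d \<and> (\<forall>i. Poly_Mapping.lookup \<alpha> i \<le> c)}"

text \<open>
  Generators are numbered \<open>f 0, \<dots>, f (m - 1)\<close>. The map \<open>\<phi>\<close> is given with codomain \<open>R[t]\<close>, the type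
  \<^typ>\<open>'r poly\<close>; its image on \<open>T = R[y\<^sub>0,\<dots>,y\<^sub>m\<^sub>-\<^sub>1]\<close> is the Rees algebra \<open>R[f\<^sub>0t,\<dots>,f\<^sub>m\<^sub>-\<^sub>1t]\<close>, so
  restricting the codomain does not change the kernel.
\<close>

definition rees_map :: "(nat \<Rightarrow> 'r::comm_ring_1) \<Rightarrow> (nat, 'r) mpol \<Rightarrow> 'r poly"
  where "rees_map f = mpol_eval (\<lambda>a. [:a:]) (\<lambda>j. monom (f j) 1)"

definition rees_ideal :: "nat \<Rightarrow> (nat \<Rightarrow> 'r::comm_ring_1) \<Rightarrow> (nat, 'r) mpol set"
  where "rees_ideal m f = {P \<in> mpols_in {..<m}. rees_map f P = 0}"

definition linear_form :: "nat \<Rightarrow> (nat \<Rightarrow> 'r::comm_ring_1) \<Rightarrow> (nat, 'r) mpol"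
  where "linear_form m a = (\<Sum>i<m. Const (a i) * Var i)"

definition linear_ideal :: "nat \<Rightarrow> (nat \<Rightarrow> 'r::comm_ring_1) \<Rightarrow> (nat, 'r) mpol set"
  where "linear_ideal m f = ideal_gen (mpols_in {..<m})
    {linear_form m a | a. (\<Sum>i<m. a i * f i) = 0}"

text \<open>
  Any finite generating system may be used: see \<open>linear_type_iff\<close> at the end of the theory for the
  independence of the choice.
\<close>

definition linear_type :: "'r::comm_ring_1 set \<Rightarrow> bool"
  where "linear_type I \<longleftrightarrow>
    (\<exists>m f. ideal_gen UNIV (f ` {..<m}) = I \<and> rees_ideal m f = linear_ideal m f)"


subsection \<open>Evaluation is a ring homomorphism\<close>

definition is_hom :: "('a::comm_ring_1 \<Rightarrow> 'b::comm_ring_1) \<Rightarrow> bool"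
  where "is_hom h \<longleftrightarrow> h 1 = 1 \<and> (\<forall>a b. h (a + b) = h a + h b) \<and> (\<forall>a b. h (a * b) = h a * h b)"

lemma is_hom_add: "is_hom h \<Longrightarrow> h (a + b) = h a + h b"
  and is_hom_mult: "is_hom h \<Longrightarrow> h (a * b) = h a * h b"
  and is_hom_1: "is_hom h \<Longrightarrow> h 1 = 1"
  by (simp_all add: is_hom_def)

lemma is_hom_0: "is_hom h \<Longrightarrow> h 0 = 0"
  using is_hom_add[of h 0 0] by simp

lemma is_hom_sum: "is_hom h \<Longrightarrow> h (sum u A) = (\<Sum>x\<in>A. h (u x))"
  by (induction A rule: infinite_finite_induct) (auto simp: is_hom_0 is_hom_add)

lemma is_hom_prod: "is_hom h \<Longrightarrow> h (prod u A) = (\<Prod>x\<in>A. h (u x))"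
  by (induction A rule: infinite_finite_induct) (auto simp: is_hom_1 is_hom_mult)

lemma is_hom_power: "is_hom h \<Longrightarrow> h (u ^ n) = h u ^ n"
  by (induction n) (auto simp: is_hom_1 is_hom_mult)

lemma is_hom_diff: "is_hom h \<Longrightarrow> h (a - b) = h a - h b"
  using is_hom_add[of h "a - b" b] by (simp add: algebra_simps)

lemma is_hom_Const: "is_hom (Const :: 'a::comm_ring_1 \<Rightarrow> ('v, 'a) mpol)"
  by (simp add: is_hom_def Const_def single_add mult_single)

lemma is_hom_pCons: "is_hom (\<lambda>a. [:a:])"
  by (simp add: is_hom_def one_pCons)

definition mon_eval :: "('v \<Rightarrow> 'b::comm_ring_1) \<Rightarrow> ('v \<Rightarrow>\<^sub>0 nat) \<Rightarrow> 'b"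
  where "mon_eval g \<alpha> = (\<Prod>v\<in>Poly_Mapping.keys \<alpha>. g v ^ Poly_Mapping.lookup \<alpha> v)"

lemma mon_eval_superset:
  assumes "finite A" "Poly_Mapping.keys \<alpha> \<subseteq> A"
  shows "mon_eval g \<alpha> = (\<Prod>v\<in>A. g v ^ Poly_Mapping.lookup \<alpha> v)"
  unfolding mon_eval_def using assms
  by (intro prod.mono_neutral_left) (auto simp: in_keys_iff)

lemma mon_eval_add: "mon_eval g (\<alpha> + \<beta>) = mon_eval g \<alpha> * mon_eval g \<beta>"
proof -
  let ?A = "Poly_Mapping.keys \<alpha> \<union> Poly_Mapping.keys \<beta>"
  have "Poly_Mapping.keys (\<alpha> + \<beta>) \<subseteq> ?A" by (rule keys_add)
  then show ?thesis
    by (simp add: mon_eval_superset[of ?A] lookup_add power_add prod.distrib)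
qed

lemma mpol_eval_superset:
  assumes "is_hom h" "finite A" "Poly_Mapping.keys P \<subseteq> A"
  shows "mpol_eval h g P = (\<Sum>\<alpha>\<in>A. h (Poly_Mapping.lookup P \<alpha>) * mon_eval g \<alpha>)"
  unfolding mpol_eval_def mon_eval_def[symmetric] using assms
  by (intro sum.mono_neutral_left) (auto simp: in_keys_iff is_hom_0)

lemma mpol_eval_add:
  assumes "is_hom h"
  shows "mpol_eval h g (P + Q) = mpol_eval h g P + mpol_eval h g Q"
proof -
  let ?A = "Poly_Mapping.keys P \<union> Poly_Mapping.keys Q"
  have "Poly_Mapping.keys (P + Q) \<subseteq> ?A" by (rule keys_add)
  then show ?thesis
    by (simp add: mpol_eval_superset[OF assms, of ?A] lookup_add is_hom_add[OF assms]
        algebra_simps sum.distrib)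
qed

lemma mpol_eval_single:
  assumes "is_hom h"
  shows "mpol_eval h g (Poly_Mapping.single \<alpha> a) = h a * mon_eval g \<alpha>"
  by (subst mpol_eval_superset[OF assms, of "{\<alpha>}"]) auto

lemma mpol_eval_zero: "mpol_eval h g 0 = 0"
  by (simp add: mpol_eval_def)

lemma mpol_eval_sum:
  assumes "is_hom h"
  shows "mpol_eval h g (sum u A) = (\<Sum>x\<in>A. mpol_eval h g (u x))"
  by (induction A rule: infinite_finite_induct)
    (auto simp: mpol_eval_zero mpol_eval_add[OF assms])

lemma mpol_expand:
  "P = (\<Sum>\<alpha>\<in>Poly_Mapping.keys P. Poly_Mapping.single \<alpha> (Poly_Mapping.lookup P \<alpha>))"
  by (rule poly_mapping_eqI)
    (auto simp: lookup_sum lookup_single when_def in_keys_iff)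

lemma mpol_eval_mult:
  assumes "is_hom h"
  shows "mpol_eval h g (P * Q) = mpol_eval h g P * mpol_eval h g Q"
proof -
  have "P * Q = (\<Sum>\<alpha>\<in>Poly_Mapping.keys P. Poly_Mapping.single \<alpha> (Poly_Mapping.lookup P \<alpha>)) *
      (\<Sum>\<beta>\<in>Poly_Mapping.keys Q. Poly_Mapping.single \<beta> (Poly_Mapping.lookup Q \<beta>))"
    by (simp only: mpol_expand[symmetric])
  also have "\<dots> = (\<Sum>\<alpha>\<in>Poly_Mapping.keys P. \<Sum>\<beta>\<in>Poly_Mapping.keys Q.
      Poly_Mapping.single (\<alpha> + \<beta>) (Poly_Mapping.lookup P \<alpha> * Poly_Mapping.lookup Q \<beta>))"
    by (simp add: sum_product mult_single)
  finally have "mpol_eval h g (P * Q) = (\<Sum>\<alpha>\<in>Poly_Mapping.keys P. \<Sum>\<beta>\<in>Poly_Mapping.keys Q.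
      (h (Poly_Mapping.lookup P \<alpha>) * mon_eval g \<alpha>) * (h (Poly_Mapping.lookup Q \<beta>) * mon_eval g \<beta>))"
    by (simp add: mpol_eval_sum[OF assms] mpol_eval_single[OF assms] mon_eval_add
        is_hom_mult[OF assms] algebra_simps)
  then show ?thesis
    by (simp add: sum_product mpol_eval_def mon_eval_def)
qed

lemma mpol_eval_Const: "is_hom h \<Longrightarrow> mpol_eval h g (Const a) = h a"
  by (simp add: Const_def mpol_eval_single mon_eval_def)

lemma mpol_eval_Var: "is_hom h \<Longrightarrow> mpol_eval h g (Var v) = g v"
  by (simp add: Var_def mpol_eval_single mon_eval_def is_hom_1)

lemma is_hom_mpol_eval: "is_hom h \<Longrightarrow> is_hom (mpol_eval h g)"
  using mpol_eval_Const[of h g 1]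
  by (simp add: is_hom_def[of "mpol_eval h g"] mpol_eval_add mpol_eval_mult is_hom_1 Const_def)

lemma mpol_eval_compose:
  assumes h: "is_hom h" and h': "is_hom h'"
  shows "h (mpol_eval h' g P) = mpol_eval (\<lambda>a. h (h' a)) (\<lambda>v. h (g v)) P"
  unfolding mpol_eval_def
  by (simp add: is_hom_sum[OF h] is_hom_mult[OF h] is_hom_prod[OF h] is_hom_power[OF h])

lemma mpol_eval_cong:
  assumes "P \<in> mpols_in V" "\<And>v. v \<in> V \<Longrightarrow> g v = g' v"
  shows "mpol_eval h g P = mpol_eval h g' P"
  unfolding mpol_eval_def
proof (intro sum.cong refl arg_cong2[where f = "(*)"] prod.cong)
  fix \<alpha> v assume "\<alpha> \<in> Poly_Mapping.keys P" "v \<in> Poly_Mapping.keys \<alpha>"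
  then have "v \<in> V" using assms(1) by (auto simp: mpols_in_def)
  then show "g v ^ Poly_Mapping.lookup \<alpha> v = g' v ^ Poly_Mapping.lookup \<alpha> v"
    by (simp add: assms(2))
qed

lemma Var_power: "Var v ^ k = Poly_Mapping.single (Poly_Mapping.single v k) 1"
  by (induction k) (auto simp: Var_def mult_single single_add[symmetric])

lemma mon_eval_Var: "mon_eval Var \<alpha> = Poly_Mapping.single \<alpha> 1"
proof -
  have "(\<Prod>v\<in>A. Var v ^ k v) = Poly_Mapping.single (\<Sum>v\<in>A. Poly_Mapping.single v (k v)) 1"
    if "finite A" for A and k :: "'a \<Rightarrow> nat"
    using that by (induction A rule: finite_induct) (auto simp: Var_power mult_single)
  moreover have "\<alpha> = (\<Sum>v\<in>Poly_Mapping.keys \<alpha>. Poly_Mapping.single v (Poly_Mapping.lookup \<alpha> v))"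
    by (rule poly_mapping_eqI) (auto simp: lookup_sum lookup_single when_def in_keys_iff)
  ultimately show ?thesis unfolding mon_eval_def by (metis finite_keys)
qed

lemma mpol_eval_Const_Var: "mpol_eval Const Var P = P"
  by (simp add: mpol_eval_def mon_eval_def[symmetric] mon_eval_Var Const_def mult_single
      mpol_expand[symmetric])


subsection \<open>The subring of polynomials in given variables\<close>

lemma mpols_in_zero: "0 \<in> mpols_in V"
  by (simp add: mpols_in_def)

lemma mpols_in_one: "1 \<in> mpols_in V"
  by (simp add: mpols_in_def)

lemma mpols_in_Const: "Const a \<in> mpols_in V"
  by (simp add: mpols_in_def Const_def)

lemma mpols_in_Var: "v \<in> V \<Longrightarrow> Var v \<in> mpols_in V"
  by (simp add: mpols_in_def Var_def)

lemma mpols_in_add: "P \<in> mpols_in V \<Longrightarrow> Q \<in> mpols_in V \<Longrightarrow> P + Q \<in> mpols_in V"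
  unfolding mpols_in_def using keys_add[of P Q] by blast

lemma mpols_in_mult:
  assumes "P \<in> mpols_in V" "Q \<in> mpols_in V"
  shows "P * Q \<in> mpols_in V"
proof -
  have "Poly_Mapping.keys \<gamma> \<subseteq> V" if \<gamma>: "\<gamma> \<in> Poly_Mapping.keys (P * Q)" for \<gamma>
  proof -
    obtain \<alpha> \<beta> where "\<gamma> = \<alpha> + \<beta>" "\<alpha> \<in> Poly_Mapping.keys P" "\<beta> \<in> Poly_Mapping.keys Q"
      using \<gamma> keys_mult[of P Q] by blast
    then show ?thesis
      using assms keys_add[of \<alpha> \<beta>] unfolding mpols_in_def by blast
  qed
  then show ?thesis by (simp add: mpols_in_def)
qed

lemma mpols_in_sum: "(\<And>x. x \<in> A \<Longrightarrow> u x \<in> mpols_in V) \<Longrightarrow> sum u A \<in> mpols_in V"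
  by (induction A rule: infinite_finite_induct) (auto intro: mpols_in_zero mpols_in_add)

lemma mpols_in_prod: "(\<And>x. x \<in> A \<Longrightarrow> u x \<in> mpols_in V) \<Longrightarrow> prod u A \<in> mpols_in V"
  by (induction A rule: infinite_finite_induct) (auto intro: mpols_in_one mpols_in_mult)

lemma mpols_in_power: "u \<in> mpols_in V \<Longrightarrow> u ^ k \<in> mpols_in V"
  by (induction k) (auto intro: mpols_in_one mpols_in_mult)

lemma mpols_in_eval:
  assumes "P \<in> mpols_in V" "\<And>v. v \<in> V \<Longrightarrow> g v \<in> mpols_in W"
  shows "mpol_eval Const g P \<in> mpols_in W"
  unfolding mpol_eval_def
proof (intro mpols_in_sum mpols_in_mult mpols_in_Const mpols_in_prod mpols_in_power assms(2))
  fix \<alpha> v assume "\<alpha> \<in> Poly_Mapping.keys P" "v \<in> Poly_Mapping.keys \<alpha>"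
  then show "v \<in> V" using assms(1) by (auto simp: mpols_in_def)
qed

lemma mpols_in_linear_form: "linear_form m a \<in> mpols_in {..<m}"
  unfolding linear_form_def
  by (intro mpols_in_sum mpols_in_mult mpols_in_Const mpols_in_Var)


subsection \<open>Generated ideals\<close>

lemma is_ideal_ideal_gen:
  assumes "is_ideal T T" "S \<subseteq> T"
  shows "is_ideal T (ideal_gen T S)"
proof -
  have T: "ideal_gen T S \<subseteq> T"
    unfolding ideal_gen_def using assms by (intro hull_minimal)
  have *: "x \<in> ideal_gen T S \<longleftrightarrow> (\<forall>I. is_ideal T I \<longrightarrow> S \<subseteq> I \<longrightarrow> x \<in> I)" for x
    by (auto simp: ideal_gen_def hull_def)
  show ?thesis
    unfolding is_ideal_def[of T "ideal_gen T S"]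
  proof (intro conjI ballI T)
    show "0 \<in> ideal_gen T S" by (simp add: * is_ideal_def)
  next
    fix a b assume "a \<in> ideal_gen T S" "b \<in> ideal_gen T S"
    then show "a + b \<in> ideal_gen T S" by (simp add: * is_ideal_def)
  next
    fix r a assume "r \<in> T" "a \<in> ideal_gen T S"
    then show "r * a \<in> ideal_gen T S" by (simp add: * is_ideal_def)
  qed
qed

lemma ideal_gen_minimal: "is_ideal T I \<Longrightarrow> S \<subseteq> I \<Longrightarrow> ideal_gen T S \<subseteq> I"
  unfolding ideal_gen_def by (rule hull_minimal)

lemma ideal_gen_inc: "x \<in> S \<Longrightarrow> x \<in> ideal_gen T S"
  unfolding ideal_gen_def by (rule hull_inc)

lemma is_ideal_mpols_in: "is_ideal (mpols_in V) (mpols_in V)"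
  by (auto simp: is_ideal_def mpols_in_zero mpols_in_add mpols_in_mult)

lemma is_ideal_linear_ideal: "is_ideal (mpols_in {..<m}) (linear_ideal m f)"
  unfolding linear_ideal_def
  by (intro is_ideal_ideal_gen is_ideal_mpols_in) (auto simp: mpols_in_linear_form)

lemma linear_ideal_inc: "(\<Sum>i<m. a i * f i) = 0 \<Longrightarrow> linear_form m a \<in> linear_ideal m f"
  unfolding linear_ideal_def by (rule ideal_gen_inc) auto

lemma ideal_gen_combination:
  assumes "x \<in> ideal_gen UNIV (f ` {..<m})"
  shows "\<exists>a. x = (\<Sum>i<m::nat. a i * f i)"
proof -
  let ?I = "{x. \<exists>a. x = (\<Sum>i<m. a i * f i)}"
  have "is_ideal UNIV ?I"
    unfolding is_ideal_def
  proof (intro conjI ballI)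
    show "0 \<in> ?I" by (auto intro: exI[of _ "\<lambda>_. 0"])
  next
    fix x y assume "x \<in> ?I" "y \<in> ?I"
    then obtain a b where "x = (\<Sum>i<m. a i * f i)" "y = (\<Sum>i<m. b i * f i)" by auto
    then have "x + y = (\<Sum>i<m. (a i + b i) * f i)"
      by (simp add: sum.distrib algebra_simps)
    then show "x + y \<in> ?I" by (auto intro: exI[of _ "\<lambda>i. a i + b i"])
  next
    fix r x assume "x \<in> ?I"
    then obtain a where "x = (\<Sum>i<m. a i * f i)" by auto
    then have "r * x = (\<Sum>i<m. (r * a i) * f i)"
      by (simp add: sum_distrib_left algebra_simps)
    then show "r * x \<in> ?I" by (auto intro: exI[of _ "\<lambda>i. r * a i"])
  qed simp
  moreover have "f ` {..<m} \<subseteq> ?I"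
  proof clarify
    fix j assume "j < m"
    then have "f j = (\<Sum>i<m. (if i = j then 1 else 0) * f i)"
      by (simp add: if_distrib[of "\<lambda>c. c * _"] cong: if_cong)
    then show "\<exists>a. f j = (\<Sum>i<m. a i * f i)"
      by (rule exI[of _ "\<lambda>i. if i = j then 1 else 0"])
  qed
  ultimately have "ideal_gen UNIV (f ` {..<m}) \<subseteq> ?I" by (rule ideal_gen_minimal)
  then show ?thesis using assms by blast
qed

text \<open>If the images of the variables agree modulo an ideal, then so do all evaluations.\<close>

lemma mpol_eval_cong_ideal:
  fixes P :: "('v, 'a::comm_ring_1) mpol"
  assumes I: "is_ideal (mpols_in W) I"
    and P: "P \<in> mpols_in V"
    and g: "\<And>v. v \<in> V \<Longrightarrow> g v \<in> mpols_in W"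
    and g': "\<And>v. v \<in> V \<Longrightarrow> g' v \<in> mpols_in W"
    and diff: "\<And>v. v \<in> V \<Longrightarrow> g v - g' v \<in> I"
  shows "mpol_eval Const g P - mpol_eval Const g' P \<in> I"
proof -
  have I0: "0 \<in> I" and Iadd: "\<And>a b. a \<in> I \<Longrightarrow> b \<in> I \<Longrightarrow> a + b \<in> I"
    and Imult: "\<And>r a. r \<in> mpols_in W \<Longrightarrow> a \<in> I \<Longrightarrow> r * a \<in> I"
    using I by (auto simp: is_ideal_def)
  have mult: "a * b - a' * b' \<in> I"
    if "a - a' \<in> I" "b - b' \<in> I" "a \<in> mpols_in W" "b' \<in> mpols_in W" for a a' b b'
  proof -
    have "a * b - a' * b' = a * (b - b') + b' * (a - a')" by (simp add: algebra_simps)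
    then show ?thesis using that by (simp add: Iadd Imult)
  qed
  have pow: "g v ^ k - g' v ^ k \<in> I" if "v \<in> V" for v k
  proof (induction k)
    case (Suc k)
    then show ?case
      using that by (auto intro!: mult diff g g' mpols_in_power)
  qed (simp add: I0)
  have prod: "(\<Prod>v\<in>A. g v ^ k v) - (\<Prod>v\<in>A. g' v ^ k v) \<in> I" if "A \<subseteq> V" for A k
    using that
  proof (induction A rule: infinite_finite_induct)
    case (insert x A)
    then show ?case
      by (auto intro!: mult pow g g' mpols_in_power mpols_in_prod)
  qed (simp_all add: I0)
  have sum: "sum u A \<in> I" if "\<And>x. x \<in> A \<Longrightarrow> u x \<in> I" for u and A :: "('v \<Rightarrow>\<^sub>0 nat) set"
    using that by (induction A rule: infinite_finite_induct) (auto intro: I0 Iadd)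
  have "mpol_eval Const g P - mpol_eval Const g' P =
      (\<Sum>\<alpha>\<in>Poly_Mapping.keys P. Const (Poly_Mapping.lookup P \<alpha>) *
        ((\<Prod>v\<in>Poly_Mapping.keys \<alpha>. g v ^ Poly_Mapping.lookup \<alpha> v) -
         (\<Prod>v\<in>Poly_Mapping.keys \<alpha>. g' v ^ Poly_Mapping.lookup \<alpha> v)))"
    by (simp add: mpol_eval_def sum_subtractf right_diff_distrib)
  moreover have "\<dots> \<in> I"
    using P by (intro sum Imult mpols_in_Const prod) (auto simp: mpols_in_def)
  ultimately show ?thesis by simp
qed


subsection \<open>Independence of the generating system\<close>

lemma is_hom_rees_map: "is_hom (rees_map f)"
  unfolding rees_map_def by (intro is_hom_mpol_eval is_hom_pCons)

lemma rees_map_Const: "rees_map f (Const a) = [:a:]"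
  unfolding rees_map_def by (rule mpol_eval_Const[OF is_hom_pCons])

lemma rees_map_Var: "rees_map f (Var j) = monom (f j) 1"
  unfolding rees_map_def by (rule mpol_eval_Var[OF is_hom_pCons])

lemma rees_map_linear_form: "rees_map f (linear_form m a) = monom (\<Sum>i<m. a i * f i) 1"
  by (simp add: linear_form_def is_hom_sum[OF is_hom_rees_map] is_hom_mult[OF is_hom_rees_map]
      rees_map_Const rees_map_Var smult_monom monom_sum)

lemma linear_ideal_subset_rees_ideal: "linear_ideal m f \<subseteq> rees_ideal m f"
  unfolding linear_ideal_def
proof (rule ideal_gen_minimal)
  show "is_ideal (mpols_in {..<m}) (rees_ideal m f)"
    by (auto simp: is_ideal_def rees_ideal_def mpols_in_zero mpols_in_add mpols_in_mult
        is_hom_0[OF is_hom_rees_map] is_hom_add[OF is_hom_rees_map] is_hom_mult[OF is_hom_rees_map])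
  show "{linear_form m a | a. (\<Sum>i<m. a i * f i) = 0} \<subseteq> rees_ideal m f"
    by (auto simp: rees_ideal_def mpols_in_linear_form rees_map_linear_form)
qed

lemma linear_form_sum:
  "(\<Sum>i\<in>A. Const (c i) * linear_form m (a i)) = linear_form m (\<lambda>j. \<Sum>i\<in>A. c i * a i j)"
proof -
  have "(\<Sum>i\<in>A. Const (c i) * linear_form m (a i)) =
      (\<Sum>i\<in>A. \<Sum>j<m. Const (c i * a i j) * Var j)"
    by (simp add: linear_form_def sum_distrib_left is_hom_mult[OF is_hom_Const] mult.assoc)
  also have "\<dots> = (\<Sum>j<m. \<Sum>i\<in>A. Const (c i * a i j) * Var j)"
    by (rule sum.swap)
  finally show ?thesis
    by (simp add: linear_form_def is_hom_sum[OF is_hom_Const] sum_distrib_right)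
qed

lemma linear_form_diff_Var:
  fixes a :: "nat \<Rightarrow> 'r::comm_ring_1"
  assumes "j < m"
  shows "linear_form m a - Var j = linear_form m (\<lambda>i. a i - (if i = j then 1 else 0))"
proof -
  have "(\<Sum>i<m. Const (if i = j then 1 else 0 :: 'r) * Var i) = (\<Sum>i<m. if i = j then Var i else 0)"
    by (rule sum.cong) (auto simp: is_hom_1[OF is_hom_Const] is_hom_0[OF is_hom_Const])
  also have "\<dots> = Var j" using assms by simp
  finally show ?thesis
    by (simp add: linear_form_def is_hom_diff[OF is_hom_Const] left_diff_distrib sum_subtractf)
qed

lemma rees_eq_linear_transfer:
  fixes f g :: "nat \<Rightarrow> 'r::comm_ring_1"
  assumes gen: "ideal_gen UNIV (f ` {..<m}) = ideal_gen UNIV (g ` {..<k})"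
    and eq: "rees_ideal m f = linear_ideal m f"
  shows "rees_ideal k g = linear_ideal k g"
proof
  show "linear_ideal k g \<subseteq> rees_ideal k g" by (rule linear_ideal_subset_rees_ideal)
next
  have "\<forall>j. \<exists>c. j < k \<longrightarrow> g j = (\<Sum>i<m. c i * f i)"
    using gen ideal_gen_combination by (metis ideal_gen_inc imageI lessThan_iff)
  then obtain a where a: "\<And>j. j < k \<Longrightarrow> g j = (\<Sum>i<m. a j i * f i)" by metis
  have "\<forall>i. \<exists>c. i < m \<longrightarrow> f i = (\<Sum>j<k. c j * g j)"
    using gen ideal_gen_combination by (metis ideal_gen_inc imageI lessThan_iff)
  then obtain b where b: "\<And>i. i < m \<Longrightarrow> f i = (\<Sum>j<k. b i j * g j)" by metis
  define A where "A = mpol_eval Const (\<lambda>j. linear_form m (a j))"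
  define B where "B = mpol_eval Const (\<lambda>i. linear_form k (b i))"
  have homA: "is_hom A" and homB: "is_hom B"
    by (simp_all add: A_def B_def is_hom_mpol_eval is_hom_Const)
  have B_linear_form: "B (linear_form m c) = linear_form k (\<lambda>j. \<Sum>i<m. c i * b i j)" for c
  proof -
    have "B (linear_form m c) = (\<Sum>i<m. Const (c i) * linear_form k (b i))"
      unfolding linear_form_def[of m c] is_hom_sum[OF homB] is_hom_mult[OF homB]
      by (simp add: B_def mpol_eval_Const mpol_eval_Var is_hom_Const)
    then show ?thesis by (simp add: linear_form_sum)
  qed
  have combine: "(\<Sum>j<k. (\<Sum>i<m. c i * b i j) * g j) = (\<Sum>i<m. c i * f i)" for c
  proof -
    have "(\<Sum>j<k. (\<Sum>i<m. c i * b i j) * g j) = (\<Sum>j<k. \<Sum>i<m. c i * b i j * g j)"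
      by (simp add: sum_distrib_right)
    also have "\<dots> = (\<Sum>i<m. \<Sum>j<k. c i * b i j * g j)" by (rule sum.swap)
    also have "\<dots> = (\<Sum>i<m. c i * f i)"
      by (rule sum.cong) (simp_all add: b sum_distrib_left mult.assoc)
    finally show ?thesis .
  qed
  have L: "is_ideal (mpols_in {..<k}) (linear_ideal k g)" by (rule is_ideal_linear_ideal)
  have B_in: "B Q \<in> mpols_in {..<k}" if "Q \<in> mpols_in {..<m}" for Q
    using that unfolding B_def by (rule mpols_in_eval) (rule mpols_in_linear_form)
  have B_linear_ideal: "linear_ideal m f \<subseteq> {Q \<in> mpols_in {..<m}. B Q \<in> linear_ideal k g}"
    unfolding linear_ideal_def[of m f]
  proof (rule ideal_gen_minimal)
    show "is_ideal (mpols_in {..<m}) {Q \<in> mpols_in {..<m}. B Q \<in> linear_ideal k g}"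
      using L B_in
      by (auto simp: is_ideal_def mpols_in_zero mpols_in_add mpols_in_mult
          is_hom_0[OF homB] is_hom_add[OF homB] is_hom_mult[OF homB])
    show "{linear_form m c |c. (\<Sum>i<m. c i * f i) = 0}
        \<subseteq> {Q \<in> mpols_in {..<m}. B Q \<in> linear_ideal k g}"
      by (auto simp: mpols_in_linear_form B_linear_form combine intro!: linear_ideal_inc)
  qed
  show "rees_ideal k g \<subseteq> linear_ideal k g"
  proof
    fix P assume "P \<in> rees_ideal k g"
    then have P: "P \<in> mpols_in {..<k}" and P0: "rees_map g P = 0"
      by (auto simp: rees_ideal_def)
    have "rees_map f (A P) = mpol_eval (\<lambda>c. [:c:]) (\<lambda>j. monom (\<Sum>i<m. a j i * f i) 1) P"
      unfolding A_def
      by (simp add: mpol_eval_compose[OF is_hom_rees_map is_hom_Const] rees_map_Const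
          rees_map_linear_form)
    also have "\<dots> = rees_map g P"
      unfolding rees_map_def using P by (rule mpol_eval_cong) (simp add: a)
    finally have "rees_map f (A P) = 0" using P0 by simp
    moreover have "A P \<in> mpols_in {..<m}"
      using P unfolding A_def by (rule mpols_in_eval) (rule mpols_in_linear_form)
    ultimately have "A P \<in> linear_ideal m f" using eq by (auto simp: rees_ideal_def)
    then have BA: "B (A P) \<in> linear_ideal k g" using B_linear_ideal by blast
    have "B (A P) = mpol_eval Const (\<lambda>j. B (linear_form m (a j))) P"
      unfolding A_def mpol_eval_compose[OF homB is_hom_Const]
      by (simp add: B_def mpol_eval_Const is_hom_Const)
    then have BA': "B (A P) - P =
        mpol_eval Const (\<lambda>j. B (linear_form m (a j))) P - mpol_eval Const Var P"
      by (simp add: mpol_eval_Const_Var)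
    have diff: "B (A P) - P \<in> linear_ideal k g"
      unfolding BA'
    proof (rule mpol_eval_cong_ideal[OF L P])
      fix j assume "j \<in> {..<k}"
      then have j: "j < k" by simp
      let ?d = "\<lambda>i. (\<Sum>l<m. a j l * b l i) - (if i = j then 1 else 0)"
      have "(\<Sum>i<k. (if i = j then 1 else 0) * g i) = g j"
        using j by (simp add: if_distrib[of "\<lambda>c. c * _"] cong: if_cong)
      then have "(\<Sum>i<k. ?d i * g i) = 0"
        by (simp add: left_diff_distrib sum_subtractf combine a[OF j, symmetric])
      then show "B (linear_form m (a j)) - Var j \<in> linear_ideal k g"
        by (simp add: B_linear_form linear_form_diff_Var[OF j] linear_ideal_inc)
    qed (auto simp: B_linear_form mpols_in_linear_form mpols_in_Var)
    have "Const (-1) = (-1 :: (nat, 'r) mpol)"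
      using is_hom_diff[OF is_hom_Const, of 0 1]
      by (simp add: is_hom_0[OF is_hom_Const] is_hom_1[OF is_hom_Const])
    then have "P = B (A P) + Const (-1) * (B (A P) - P)" by simp
    moreover have "Const (-1) * (B (A P) - P) \<in> linear_ideal k g"
      using L diff mpols_in_Const[of "-1 :: 'r" "{..<k}"] by (auto simp: is_ideal_def)
    ultimately show "P \<in> linear_ideal k g"
      using L BA unfolding is_ideal_def by metis
  qed
qed

theorem linear_type_iff:
  assumes "ideal_gen UNIV (f ` {..<m}) = I"
  shows "linear_type I \<longleftrightarrow> rees_ideal m f = linear_ideal m f"
  unfolding linear_type_def using assms rees_eq_linear_transfer by metis

end

theory Submission
  imports Defs "HOL-Library.FuncSet"
begin

text \<open>
  All ideals involved are generated by monomials \<open>f\<^sub>l = x\<^bsup>e l\<^esup>\<close>. The kernel \<open>J\<close> is then spanned by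
  binomials \<open>x\<^bsup>a\<^esup> y\<^bsup>b\<^esup> - x\<^bsup>a'\<^esup> y\<^bsup>b'\<^esup>\<close> with equal images. Such a binomial lies in \<open>L\<close>, by induction on
  the degree of \<open>y\<^bsup>b\<^esup>\<close>: a common variable \<open>y\<^sub>j\<close> can be cancelled, and if there is none, it suffices
  that \<open>x\<^bsup>a\<^esup> f\<^sub>i = x\<^bsup>a''\<^esup> f\<^sub>j\<close> for some \<open>y\<^sub>i\<close> dividing \<open>y\<^bsup>b\<^esup>\<close> and some \<open>y\<^sub>j\<close> dividing \<open>y\<^bsup>b'\<^esup>\<close>, since
  the linear relation \<open>x\<^bsup>a\<^esup> y\<^sub>i - x\<^bsup>a''\<^esup> y\<^sub>j\<close> then creates a common variable. This exchange is possible
  for the variables themselves (\<open>d = 1\<close>) and for the monomials \<open>(x\<^sub>1 \<cdots> x\<^sub>n)\<^bsup>c\<^esup> / x\<^sub>i\<close> (\<open>d = n c - 1\<close>).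

  Conversely, the coefficients of a linear relation between minimal generators have no constant term,
  so \<open>L\<close> vanishes modulo \<open>(x\<^sub>1, \<dots>, x\<^sub>n)\<close>, whereas a quadratic relation \<open>y\<^sub>p y\<^sub>q - y\<^sub>r y\<^sub>s\<close> does not. If
  \<open>n \<ge> 2\<close> and \<open>2 \<le> d \<le> n c - 2\<close>, such a relation comes from \<open>(u x\<^sub>i\<^sup>2) (u x\<^sub>j\<^sup>2) = (u x\<^sub>i x\<^sub>j)\<^sup>2\<close> for
  \<open>c \<ge> 2\<close> and from \<open>(u x\<^sub>1 x\<^sub>2) (u x\<^sub>3 x\<^sub>4) = (u x\<^sub>1 x\<^sub>3) (u x\<^sub>2 x\<^sub>4)\<close> for \<open>c = 1\<close>.
\<close>

section \<open>Weights of exponent vectors\<close>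

text \<open>The iterated sum makes one notion serve several monoids: with weights \<open>e\<close>
  it is the exponent vector in x of the image of y^b, with constant weight 1 it is the degree of
  y^b.\<close>

definition weight :: "('v \<Rightarrow> 'c::comm_monoid_add) \<Rightarrow> ('v \<Rightarrow>\<^sub>0 nat) \<Rightarrow> 'c"
  where "weight w b = (\<Sum>l\<in>Poly_Mapping.keys b. \<Sum>_<Poly_Mapping.lookup b l. w l)"

lemma weight_superset:
  assumes "finite A" "Poly_Mapping.keys b \<subseteq> A"
  shows "weight w b = (\<Sum>l\<in>A. \<Sum>_<Poly_Mapping.lookup b l. w l)"
  unfolding weight_def using assms
  by (intro sum.mono_neutral_left) (auto simp: in_keys_iff)

lemma sum_lessThan_add_const:
  "(\<Sum>_<m + n. w) = (\<Sum>_<m. w) + (\<Sum>_<n::nat. w :: 'c::comm_monoid_add)"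
  by (induction n) (auto simp: ac_simps)

lemma weight_add: "weight w (a + b) = weight w a + weight w b"
proof -
  let ?A = "Poly_Mapping.keys a \<union> Poly_Mapping.keys b"
  have "Poly_Mapping.keys (a + b) \<subseteq> ?A" by (rule keys_add)
  then show ?thesis
    by (simp add: weight_superset[of ?A] lookup_add sum_lessThan_add_const sum.distrib)
qed

lemma weight_single: "weight w (Poly_Mapping.single l 1) = w l"
  by (simp add: weight_superset[of "{l}"])

lemma weight_zero [simp]: "weight w 0 = 0"
  by (simp add: weight_def)

lemma weight_nat: "weight w b = (\<Sum>l\<in>Poly_Mapping.keys b. Poly_Mapping.lookup b l * w l)"
  for w :: "'v \<Rightarrow> nat"
  by (simp add: weight_def)

lemma weight_const_nat: "weight (\<lambda>_. k :: nat) b = weight (\<lambda>_. 1) b * k"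
  by (simp add: weight_nat sum_distrib_right)

lemma weight_plus: "weight (\<lambda>l. w l + w' l) b = weight w b + weight w' b"
  by (simp add: weight_def sum.distrib)

lemma lookup_weight:
  "Poly_Mapping.lookup (weight e b) v = weight (\<lambda>l. Poly_Mapping.lookup (e l) v) b"
  by (simp add: weight_def lookup_sum)

lemma weight_one_eq_0_iff: "weight (\<lambda>_. 1 :: nat) b = 0 \<longleftrightarrow> b = 0"
  by (auto simp: weight_nat in_keys_iff simp flip: keys_eq_empty)

text \<open>Serves to read the exponent of y_i in y^b off an exponent of the image: by injectivity
  of \<open>u\<close>, only \<open>l = i\<close> has the label \<open>u i\<close>.\<close>

lemma weight_delta:
  assumes "inj_on u V" "Poly_Mapping.keys b \<subseteq> V" "i \<in> V"
  shows "weight (\<lambda>l. if u l = u i then 1 else 0 :: nat) b = Poly_Mapping.lookup b i"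
proof -
  have "weight (\<lambda>l. if u l = u i then 1 else 0 :: nat) b =
      (\<Sum>l\<in>Poly_Mapping.keys b. if l = i then Poly_Mapping.lookup b l else 0)"
    unfolding weight_nat using assms by (intro sum.cong) (auto simp: inj_on_def)
  then show ?thesis by (simp add: in_keys_iff)
qed

text \<open>Subtraction of exponents is truncated; it is exact here because the exponent at
  \<open>i\<close> is at least 1.\<close>

lemma split_off_key:
  assumes "i \<in> Poly_Mapping.keys b"
  obtains b0 where "b = Poly_Mapping.single i (1::nat) + b0" "Poly_Mapping.keys b0 \<subseteq> Poly_Mapping.keys b"
proof
  let ?b0 = "b - Poly_Mapping.single i 1"
  show "b = Poly_Mapping.single i 1 + ?b0"
    using assms by (intro poly_mapping_eqI)
      (auto simp: lookup_add lookup_minus lookup_single when_def in_keys_iff)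
  show "Poly_Mapping.keys ?b0 \<subseteq> Poly_Mapping.keys b"
    by (auto simp: in_keys_iff lookup_minus)
qed

section \<open>Monomials\<close>

text \<open>The term k x^a y^b of K[x][y]: the outer exponent vector belongs to the y's, the inner
  one to the x's.\<close>

abbreviation Mono :: "('n \<Rightarrow>\<^sub>0 nat) \<Rightarrow> ('v \<Rightarrow>\<^sub>0 nat) \<Rightarrow> 'k \<Rightarrow> ('v, ('n, 'k::comm_ring_1) mpol) mpol"
  where "Mono a b k \<equiv> Poly_Mapping.single b (Poly_Mapping.single a k)"

lemma single_monomial_power:
  "(Poly_Mapping.single \<alpha> 1 :: ('n, 'k::comm_ring_1) mpol) ^ k = Poly_Mapping.single (\<Sum>_<k. \<alpha>) 1"
  by (induction k) (auto simp: mult_single ac_simps)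

text \<open>Terms are mapped to terms, so the kernel can be analysed separately on each set of terms
  with the same image monomial.\<close>

lemma rees_map_Mono:
  fixes e :: "nat \<Rightarrow> 'n \<Rightarrow>\<^sub>0 nat" and k :: "'k::comm_ring_1"
  shows "rees_map (\<lambda>l. Poly_Mapping.single (e l) 1) (Mono a b k) =
    monom (Poly_Mapping.single (a + weight e b) k) (weight (\<lambda>_. 1) b)"
proof -
  have "(\<Prod>l\<in>A. monom (Poly_Mapping.single (e l) 1 :: ('n, 'k) mpol) 1 ^ n l) =
      monom (Poly_Mapping.single (\<Sum>l\<in>A. \<Sum>_<n l. e l) 1) (\<Sum>l\<in>A. n l)"
    if "finite A" for A and n :: "nat \<Rightarrow> nat"
    using that
    by (induction A rule: finite_induct)
      (auto simp: monom_power single_monomial_power mult_monom mult_single)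
  then have "mon_eval (\<lambda>l. monom (Poly_Mapping.single (e l) 1 :: ('n, 'k) mpol) 1) b =
      monom (Poly_Mapping.single (weight e b) 1) (weight (\<lambda>_. 1) b)"
    by (simp add: mon_eval_def weight_def)
  then show ?thesis
    by (simp add: rees_map_def mpol_eval_single[OF is_hom_pCons] smult_monom mult_single)
qed

text \<open>Provides the binomial linear relations. Writing the coefficients as a difference keeps
  the formula right for \<open>i = j\<close>.\<close>

lemma linear_form_two:
  assumes "i < m" "j < m"
  shows "linear_form m (\<lambda>l. (if l = i then r else 0) - (if l = j then s else 0)) =
    Poly_Mapping.single (Poly_Mapping.single i 1) r - Poly_Mapping.single (Poly_Mapping.single j 1) s"
proof -
  have "(\<Sum>l<m. Const (if l = i then r else 0) * Var l) =
      (Poly_Mapping.single (Poly_Mapping.single i 1) r :: (nat, 'a) mpol)"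
    if "i < m" for i and r :: 'a
  proof -
    have "(\<Sum>l<m. Const (if l = i then r else 0) * Var l) =
        (\<Sum>l<m. if l = i then Poly_Mapping.single (Poly_Mapping.single i 1) r else 0)"
      by (rule sum.cong) (auto simp: Const_def Var_def mult_single)
    then show ?thesis using that by simp
  qed
  then show ?thesis
    using assms by (simp add: linear_form_def is_hom_diff[OF is_hom_Const] left_diff_distrib sum_subtractf)
qed

section \<open>Monomial ideals of linear type\<close>

text \<open>Reduces linear type to an exchange property of exponents. It concerns only nonconstant
  y^b and y^b' of equal degree with disjoint supports, since a shared variable can be
  cancelled.\<close>

lemma linear_type_monomialI:
  fixes e :: "nat \<Rightarrow> 'n \<Rightarrow>\<^sub>0 nat" and m :: nat
  defines "f \<equiv> \<lambda>l. Poly_Mapping.single (e l) 1 :: ('n, 'k::comm_ring_1) mpol"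
  assumes exch: "\<And>a b a' b'. Poly_Mapping.keys b \<subseteq> {..<m} \<Longrightarrow> Poly_Mapping.keys b' \<subseteq> {..<m} \<Longrightarrow>
      b \<noteq> 0 \<Longrightarrow> b' \<noteq> 0 \<Longrightarrow> Poly_Mapping.keys b \<inter> Poly_Mapping.keys b' = {} \<Longrightarrow>
      weight (\<lambda>_. 1::nat) b = weight (\<lambda>_. 1) b' \<Longrightarrow> a + weight e b = a' + weight e b' \<Longrightarrow>
      \<exists>i\<in>Poly_Mapping.keys b. \<exists>j\<in>Poly_Mapping.keys b'. \<exists>a''. a + e i = a'' + e j"
  shows "rees_ideal m f = linear_ideal m f"
proof
  show "linear_ideal m f \<subseteq> rees_ideal m f" by (rule linear_ideal_subset_rees_ideal)
  let ?L = "linear_ideal m f"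
  have L: "is_ideal (mpols_in {..<m}) ?L" by (rule is_ideal_linear_ideal)
  have L0: "0 \<in> ?L" and Ladd: "\<And>a b. a \<in> ?L \<Longrightarrow> b \<in> ?L \<Longrightarrow> a + b \<in> ?L"
    and Lmult: "\<And>r a. r \<in> mpols_in {..<m} \<Longrightarrow> a \<in> ?L \<Longrightarrow> r * a \<in> ?L"
    using L by (auto simp: is_ideal_def)
  have Mono_in: "Mono a b k \<in> mpols_in {..<m}" if "Poly_Mapping.keys b \<subseteq> {..<m}" for a b and k :: 'k
    using that by (auto simp: mpols_in_def)
  have cancel: "Mono a (Poly_Mapping.single j 1 + b) 1 - Mono a' (Poly_Mapping.single j 1 + b') (1::'k) \<in> ?L"
    if "Mono a b 1 - Mono a' b' (1::'k) \<in> ?L" "j < m" for a b a' b' j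
  proof -
    have "Mono a (Poly_Mapping.single j 1 + b) 1 - Mono a' (Poly_Mapping.single j 1 + b') (1::'k) =
        Mono 0 (Poly_Mapping.single j 1) 1 * (Mono a b 1 - Mono a' b' 1)"
      by (simp add: right_diff_distrib mult_single)
    then show ?thesis using that by (simp only:) (intro Lmult Mono_in, auto)
  qed
  \<comment> \<open>Induction on the common degree \<open>n\<close> in y. For \<open>n = 0\<close>
    both y-parts are 1, so the x-parts agree and the binomial is 0.\<close>
  have bin: "Mono a b 1 - Mono a' b' (1::'k) \<in> ?L"
    if "Poly_Mapping.keys b \<subseteq> {..<m}" "Poly_Mapping.keys b' \<subseteq> {..<m}"
      "weight (\<lambda>_. 1) b = n" "weight (\<lambda>_. 1) b' = n" "a + weight e b = a' + weight e b'"
    for a b a' b' and n :: nat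
    using that
  proof (induction n arbitrary: a b a' b')
    case 0
    then have "b = 0" "b' = 0" by (simp_all only: weight_one_eq_0_iff)
    then show ?case using 0 L0 by simp
  next
    case (Suc n)
    \<comment> \<open>Cancelling the shared y_j lowers the degree to \<open>n\<close>. Here
      \<open>a\<close> and \<open>b\<close> stay arbitrary, because the fact is applied both to the
      given pair and to the pair obtained by an exchange.\<close>
    have common: "Mono a b 1 - Mono a' b' (1::'k) \<in> ?L"
      if j: "j \<in> Poly_Mapping.keys b" "j \<in> Poly_Mapping.keys b'"
        and b: "Poly_Mapping.keys b \<subseteq> {..<m}" "weight (\<lambda>_. 1) b = Suc n"
          "a + weight e b = a' + weight e b'" for a b j
    proof -
      obtain c where c: "b = Poly_Mapping.single j 1 + c" "Poly_Mapping.keys c \<subseteq> Poly_Mapping.keys b"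
        using j(1) by (rule split_off_key)
      obtain c' where c': "b' = Poly_Mapping.single j 1 + c'" "Poly_Mapping.keys c' \<subseteq> Poly_Mapping.keys b'"
        using j(2) by (rule split_off_key)
      have "Mono a c 1 - Mono a' c' (1::'k) \<in> ?L"
      proof (rule Suc.IH)
        show "Poly_Mapping.keys c \<subseteq> {..<m}" "Poly_Mapping.keys c' \<subseteq> {..<m}"
          using c(2) c'(2) b(1) Suc.prems(2) by blast+
        show "weight (\<lambda>_. 1) c = n"
          using b(2) unfolding c(1) weight_add weight_single by simp
        show "weight (\<lambda>_. 1) c' = n"
          using Suc.prems(4) unfolding c'(1) weight_add weight_single by simp
        have "e j + (a + weight e c) = e j + (a' + weight e c')"
          using b(3) unfolding c(1) c'(1) weight_add weight_single by (simp add: ac_simps)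
        then show "a + weight e c = a' + weight e c'" by simp
      qed
      then show ?thesis unfolding c(1) c'(1) using j(1) b(1) by (intro cancel) auto
    qed
    show ?case
    proof (cases "Poly_Mapping.keys b \<inter> Poly_Mapping.keys b' = {}")
      case False
      then show ?thesis using common Suc.prems by blast
    next
      case True
      have "b \<noteq> 0" "b' \<noteq> 0" using Suc.prems(3,4) by auto
      then obtain i j a'' where i: "i \<in> Poly_Mapping.keys b" and j: "j \<in> Poly_Mapping.keys b'"
        and a'': "a + e i = a'' + e j"
        using exch[of b b' a a'] Suc.prems True by auto
      have ij: "i < m" "j < m" using i j Suc.prems by auto
      obtain c where c: "b = Poly_Mapping.single i 1 + c" "Poly_Mapping.keys c \<subseteq> Poly_Mapping.keys b"
        using i by (rule split_off_key)
      \<comment> \<open>\<open>?b\<close> arises from \<open>b\<close> by replacing one y_i by y_j.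
        The binomial is split at x^a'' y^?b: the first part is a multiple of the linear relation
        with coefficients \<open>?s\<close>, the second has y_j in common with y^b'.\<close>
      let ?b = "Poly_Mapping.single j 1 + c"
      let ?s = "\<lambda>l. (if l = i then Poly_Mapping.single a 1 else 0) -
        (if l = j then Poly_Mapping.single a'' 1 else (0 :: ('n, 'k) mpol))"
      have "(\<Sum>l<m. ?s l * f l) =
          (\<Sum>l<m. if l = i then Poly_Mapping.single a 1 * f l else 0) -
          (\<Sum>l<m. if l = j then Poly_Mapping.single a'' 1 * f l else 0)"
        unfolding sum_subtractf[symmetric] by (rule sum.cong) (auto simp: left_diff_distrib)
      also have "\<dots> = 0" using ij a'' by (simp add: f_def mult_single)
      finally have "linear_form m ?s \<in> ?L" by (rule linear_ideal_inc)
      then have "Mono 0 c 1 * linear_form m ?s \<in> ?L"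
        using c(2) Suc.prems(1) by (intro Lmult Mono_in) auto
      then have 1: "Mono a b 1 - Mono a'' ?b (1::'k) \<in> ?L"
        by (simp add: linear_form_two[OF ij] right_diff_distrib mult_single c(1) ac_simps)
      have 2: "Mono a'' ?b 1 - Mono a' b' (1::'k) \<in> ?L"
      proof (rule common[of j])
        show "j \<in> Poly_Mapping.keys ?b" by (simp add: in_keys_iff lookup_add)
        show "Poly_Mapping.keys ?b \<subseteq> {..<m}"
          using keys_add[of "Poly_Mapping.single j 1" c] c(2) Suc.prems(1) ij by auto
        show "weight (\<lambda>_. 1) ?b = Suc n"
          using Suc.prems(3) unfolding c(1) weight_add weight_single by simp
        have "a'' + weight e ?b = (a'' + e j) + weight e c"
          unfolding weight_add weight_single by (simp add: ac_simps)
        also have "\<dots> = a + weight e b"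
          unfolding a''[symmetric] c(1) weight_add weight_single by (simp add: ac_simps)
        finally show "a'' + weight e ?b = a' + weight e b'" using Suc.prems(5) by simp
      qed (rule j)
      show ?thesis using Ladd[OF 1 2] by simp
    qed
  qed
  show "rees_ideal m f \<subseteq> ?L"
  proof
    fix P assume "P \<in> rees_ideal m f"
    then have P: "P \<in> mpols_in {..<m}" and P0: "rees_map f P = 0"
      by (auto simp: rees_ideal_def)
    \<comment> \<open>\<open>X\<close> indexes the terms of \<open>P\<close>, with coefficients
      \<open>k\<close>; \<open>N\<close> gives the x-exponent and the t-degree of the image of a
      term.\<close>
    define X where "X = Sigma (Poly_Mapping.keys P) (\<lambda>b. Poly_Mapping.keys (Poly_Mapping.lookup P b))"
    define k where "k = (\<lambda>(b, a). Poly_Mapping.lookup (Poly_Mapping.lookup P b) a)"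
    define M :: "(nat \<Rightarrow>\<^sub>0 nat) \<times> ('n \<Rightarrow>\<^sub>0 nat) \<Rightarrow> 'k \<Rightarrow> (nat, ('n, 'k) mpol) mpol"
      where "M = (\<lambda>(b, a) k. Mono a b k)"
    define N where "N = (\<lambda>(b, a). (a + weight e b, weight (\<lambda>_. 1::nat) b))"
    \<comment> \<open>One fixed preimage for each image monomial; it need not be a term of
      \<open>P\<close>.\<close>
    define rep where "rep z = (SOME y. Poly_Mapping.keys (fst y) \<subseteq> {..<m} \<and> N y = z)" for z
    have finX: "finite X" by (simp add: X_def)
    have keysX: "Poly_Mapping.keys (fst x) \<subseteq> {..<m}" if "x \<in> X" for x
      using that P by (auto simp: X_def mpols_in_def)
    have rep: "Poly_Mapping.keys (fst (rep (N x))) \<subseteq> {..<m} \<and> N (rep (N x)) = N x" if "x \<in> X" for x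
      unfolding rep_def by (rule someI[of _ x]) (simp add: keysX that)
    have "P = (\<Sum>b\<in>Poly_Mapping.keys P. \<Sum>a\<in>Poly_Mapping.keys (Poly_Mapping.lookup P b). M (b, a) (k (b, a)))"
    proof -
      have "Poly_Mapping.single b (Poly_Mapping.lookup P b) =
          (\<Sum>a\<in>Poly_Mapping.keys (Poly_Mapping.lookup P b). M (b, a) (k (b, a)))" for b
      proof -
        have "Poly_Mapping.single b (sum u A) = (\<Sum>a\<in>A. Poly_Mapping.single b (u a))"
          for A and u :: "('n \<Rightarrow>\<^sub>0 nat) \<Rightarrow> ('n, 'k) mpol"
          by (induction A rule: infinite_finite_induct) (auto simp: single_add)
        then show ?thesis
          by (subst mpol_expand[of "Poly_Mapping.lookup P b"]) (simp add: M_def k_def)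
      qed
      then show ?thesis by (subst mpol_expand[of P]) simp
    qed
    also have "\<dots> = (\<Sum>x\<in>X. M x (k x))" by (simp add: X_def sum.Sigma)
    finally have P_eq: "P = (\<Sum>x\<in>X. M x (k x))" .
    have M_sum: "M y (sum u A) = (\<Sum>x\<in>A. M y (u x))" for y A and u :: "_ \<Rightarrow> 'k"
      by (induction A rule: infinite_finite_induct) (auto simp: M_def single_add split: prod.splits)
    \<comment> \<open>This sum is the coefficient of the monomial \<open>z\<close> in the image of
      \<open>P\<close>, which is 0.\<close>
    have class_sum: "(\<Sum>x\<in>{x \<in> X. N x = z}. k x) = 0" for z
    proof -
      have r: "rees_map f (M x c) = monom (Poly_Mapping.single (fst (N x)) c) (snd (N x))" for x c
        by (cases x) (simp add: M_def N_def f_def rees_map_Mono)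
      have "0 = Poly_Mapping.lookup (coeff (rees_map f P) (snd z)) (fst z)" by (simp add: P0)
      also have "\<dots> = (\<Sum>x\<in>X. if N x = z then k x else 0)"
        unfolding P_eq is_hom_sum[OF is_hom_rees_map] r coeff_sum lookup_sum
        by (rule sum.cong) (auto simp: lookup_single when_def prod_eq_iff)
      also have "\<dots> = (\<Sum>x\<in>{x \<in> X. N x = z}. k x)"
        using finX by (simp add: sum.inter_filter)
      finally show ?thesis by simp
    qed
    \<comment> \<open>After every term is moved to its representative, everything cancels within
      each fibre of \<open>N\<close>. Hence \<open>P\<close> is a combination of binomials, each a
      term minus its representative.\<close>
    have "(\<Sum>x\<in>X. M (rep (N x)) (k x)) = (\<Sum>z\<in>N ` X. \<Sum>x\<in>{x \<in> X. N x = z}. M (rep (N x)) (k x))"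
      using finX by (rule sum.image_gen)
    also have "\<dots> = (\<Sum>z\<in>N ` X. M (rep z) (\<Sum>x\<in>{x \<in> X. N x = z}. k x))"
      unfolding M_sum by (intro sum.cong) auto
    \<comment> \<open>The empty sum in \<open>M_sum\<close> shows that a term with coefficient 0
      vanishes.\<close>
    also have "\<dots> = 0" using M_sum[of _ _ "{}"] by (simp add: class_sum)
    finally have P_diff: "P = (\<Sum>x\<in>X. M x (k x) - M (rep (N x)) (k x))"
      by (simp add: sum_subtractf P_eq)
    have diff: "M x (k x) - M (rep (N x)) (k x) \<in> ?L" if "x \<in> X" for x
    proof -
      obtain b a where x: "x = (b, a)" by force
      obtain b' a' where y: "rep (N x) = (b', a')" by force
      have "Mono a b 1 - Mono a' b' (1::'k) \<in> ?L"
        by (rule bin) (use rep[OF that] keysX[OF that] in \<open>auto simp: y, auto simp: x N_def\<close>)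
      then have "Mono 0 0 (k x) * (Mono a b 1 - Mono a' b' (1::'k)) \<in> ?L"
        by (intro Lmult Mono_in) auto
      then show ?thesis by (simp only: x y[unfolded x] M_def) (simp add: right_diff_distrib mult_single)
    qed
    have sum: "sum u A \<in> ?L" if "\<And>x. x \<in> A \<Longrightarrow> u x \<in> ?L"
      for u and A :: "((nat \<Rightarrow>\<^sub>0 nat) \<times> ('n \<Rightarrow>\<^sub>0 nat)) set"
      using that by (induction A rule: infinite_finite_induct) (auto intro: L0 Ladd)
    show "P \<in> ?L" unfolding P_diff by (rule sum) (rule diff)
  qed
qed

section \<open>The obstruction\<close>

lemma lookup_mult_single_one:
  fixes r :: "('n, 'k::comm_ring_1) mpol"
  shows "Poly_Mapping.lookup (r * Poly_Mapping.single \<beta> 1) \<gamma> =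
    (\<Sum>\<alpha>\<in>Poly_Mapping.keys r. if \<alpha> + \<beta> = \<gamma> then Poly_Mapping.lookup r \<alpha> else 0)"
proof -
  have "r * Poly_Mapping.single \<beta> 1 =
      (\<Sum>\<alpha>\<in>Poly_Mapping.keys r. Poly_Mapping.single (\<alpha> + \<beta>) (Poly_Mapping.lookup r \<alpha>))"
    by (subst mpol_expand[of r]) (simp add: sum_distrib_right mult_single)
  then show ?thesis by (simp add: lookup_sum lookup_single when_def)
qed

text \<open>The constant term is the value at the origin, and evaluation is a homomorphism.\<close>

lemma is_hom_constant_term:
  "is_hom (\<lambda>r :: ('n, 'k::comm_ring_1) mpol. Poly_Mapping.lookup r 0)"
proof -
  have "Poly_Mapping.lookup r 0 = mpol_eval (\<lambda>c. c) (\<lambda>_. 0) r" for r :: "('n, 'k) mpol"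
  proof -
    have "(\<Prod>v\<in>Poly_Mapping.keys \<alpha>. 0 ^ Poly_Mapping.lookup \<alpha> v) = (if \<alpha> = 0 then 1 else 0 :: 'k)"
      for \<alpha> :: "'n \<Rightarrow>\<^sub>0 nat"
    proof (cases "\<alpha> = 0")
      case False
      then obtain v where v: "v \<in> Poly_Mapping.keys \<alpha>" by (metis all_not_in_conv keys_eq_empty)
      have "\<exists>v\<in>Poly_Mapping.keys \<alpha>. 0 ^ Poly_Mapping.lookup \<alpha> v = (0 :: 'k)"
        by (rule bexI[OF _ v]) (use v in \<open>simp add: in_keys_iff power_0_left\<close>)
      then show ?thesis using False by (simp add: prod_zero)
    qed simp
    then have "mpol_eval (\<lambda>c. c) (\<lambda>_. 0) r =
        (\<Sum>\<alpha>\<in>Poly_Mapping.keys r. if \<alpha> = 0 then Poly_Mapping.lookup r 0 else 0)"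
      unfolding mpol_eval_def by (intro sum.cong) auto
    then show ?thesis by (simp add: in_keys_iff)
  qed
  moreover have "is_hom (\<lambda>c :: 'k. c)" by (simp add: is_hom_def)
  ultimately show ?thesis using is_hom_mpol_eval[of "\<lambda>c. c" "\<lambda>_. 0"] by simp
qed

text \<open>Setting all x_i to 0 kills the linear relations, because no generator divides another,
  but it does not kill the quadratic relation y_p y_q - y_r y_s.\<close>

lemma not_linear_type_monomialI:
  fixes e :: "nat \<Rightarrow> 'n \<Rightarrow>\<^sub>0 nat" and m :: nat
  defines "f \<equiv> \<lambda>l. Poly_Mapping.single (e l) 1 :: ('n, 'k::comm_ring_1) mpol"
  assumes minimal: "\<And>i j \<gamma>. i < m \<Longrightarrow> j < m \<Longrightarrow> \<gamma> + e j = e i \<Longrightarrow> i = j"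
    and pqrs: "p < m" "q < m" "r < m" "s < m" "e p + e q = e r + e s" "p \<noteq> r" "p \<noteq> s"
  shows "rees_ideal m f \<noteq> linear_ideal m f"
proof
  assume eq: "rees_ideal m f = linear_ideal m f"
  define P where "P = (Var p * Var q - Var r * Var s :: (nat, ('n, 'k) mpol) mpol)"
  have "Const (- 1) = (- 1 :: (nat, ('n, 'k) mpol) mpol)"
    using is_hom_diff[OF is_hom_Const, of 0 1]
    by (simp add: is_hom_0[OF is_hom_Const] is_hom_1[OF is_hom_Const])
  then have "P = Var p * Var q + Const (- 1) * (Var r * Var s)"
    by (simp add: P_def)
  then have "P \<in> mpols_in {..<m}"
    using pqrs by (auto intro!: mpols_in_add mpols_in_mult mpols_in_Var mpols_in_Const)
  moreover have "rees_map f P = 0"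
    using pqrs(5)
    by (simp add: P_def is_hom_diff[OF is_hom_rees_map] is_hom_mult[OF is_hom_rees_map] rees_map_Var
        mult_monom f_def mult_single)
  ultimately have PL: "P \<in> linear_ideal m f" using eq by (auto simp: rees_ideal_def)
  \<comment> \<open>A point in y-space that separates the two products: y_p y_q takes the value 1
    there, while y_r y_s does so only if r and s both lie in {p, q}.\<close>
  define g where "g l = (if l = p \<or> l = q then 1 else 0 :: 'k)" for l
  define \<psi> where "\<psi> = mpol_eval (\<lambda>r :: ('n, 'k) mpol. Poly_Mapping.lookup r 0) g"
  have hom: "is_hom \<psi>" unfolding \<psi>_def by (intro is_hom_mpol_eval is_hom_constant_term)
  have \<psi>_Var: "\<psi> (Var l) = g l" for l unfolding \<psi>_def by (rule mpol_eval_Var[OF is_hom_constant_term])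
  have \<psi>_Const: "\<psi> (Const c) = Poly_Mapping.lookup c 0" for c
    unfolding \<psi>_def by (rule mpol_eval_Const[OF is_hom_constant_term])
  \<comment> \<open>Compare coefficients of x^(e i) in the syzygy: by minimality only the constant
    term of \<open>a i\<close> contributes.\<close>
  have const: "Poly_Mapping.lookup (a i) 0 = 0" if "(\<Sum>l<m. a l * f l) = 0" "i < m" for a i
  proof -
    have "0 = (\<Sum>l<m. Poly_Mapping.lookup (a l * f l) (e i))"
      using that(1) by (simp flip: lookup_sum)
    also have "\<dots> = (\<Sum>l<m. if l = i then Poly_Mapping.lookup (a i) 0 else 0)"
    proof (rule sum.cong)
      fix l assume l: "l \<in> {..<m}"
      have "\<gamma> + e l = e i \<longleftrightarrow> \<gamma> = 0 \<and> l = i" for \<gamma>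
        using minimal[of i l \<gamma>] that(2) l by auto
      then have "Poly_Mapping.lookup (a l * f l) (e i) =
          (\<Sum>\<alpha>\<in>Poly_Mapping.keys (a l). if \<alpha> = 0 then if l = i then Poly_Mapping.lookup (a l) 0 else 0 else 0)"
        unfolding f_def lookup_mult_single_one by (intro sum.cong) auto
      then show "Poly_Mapping.lookup (a l * f l) (e i) = (if l = i then Poly_Mapping.lookup (a i) 0 else 0)"
        by (auto simp: in_keys_iff)
    qed simp
    finally show ?thesis using that(2) by simp
  qed
  have "linear_ideal m f \<subseteq> {Q \<in> mpols_in {..<m}. \<psi> Q = 0}"
    unfolding linear_ideal_def
  proof (rule ideal_gen_minimal)
    show "is_ideal (mpols_in {..<m}) {Q \<in> mpols_in {..<m}. \<psi> Q = 0}"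
      by (auto simp: is_ideal_def mpols_in_zero mpols_in_add mpols_in_mult
          is_hom_0[OF hom] is_hom_add[OF hom] is_hom_mult[OF hom])
    have "\<psi> (linear_form m a) = 0" if "(\<Sum>l<m. a l * f l) = 0" for a
      unfolding linear_form_def is_hom_sum[OF hom] is_hom_mult[OF hom] \<psi>_Const
      using const[OF that] by simp
    then show "{linear_form m a |a. (\<Sum>i<m. a i * f i) = 0} \<subseteq> {Q \<in> mpols_in {..<m}. \<psi> Q = 0}"
      by (auto simp: mpols_in_linear_form)
  qed
  then have "g r * g s = g p * g q"
    using PL by (auto simp: P_def is_hom_diff[OF hom] is_hom_mult[OF hom] \<psi>_Var)
  \<comment> \<open>Since \<open>g p * g q\<close> is 1, both r and s lie in {p, q}, and p is
    excluded for each.\<close>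
  then have "r = q" "s = q" using pqrs(6,7) by (auto simp: g_def split: if_splits)
  then have "0 + e p = e q" using pqrs(5) by simp
  then show False using minimal[of q p 0] pqrs \<open>r = q\<close> by simp
qed

section \<open>Bounded Veronese ideals\<close>

lemma finite_bounded_exponents: "finite {\<alpha> :: 'n::finite \<Rightarrow>\<^sub>0 nat. \<forall>i. Poly_Mapping.lookup \<alpha> i \<le> c}"
proof (rule finite_imageD)
  show "finite (Poly_Mapping.lookup ` {\<alpha> :: 'n \<Rightarrow>\<^sub>0 nat. \<forall>i. Poly_Mapping.lookup \<alpha> i \<le> c})"
    by (rule finite_subset[of _ "Pi\<^sub>E UNIV (\<lambda>_. {..c})"]) (auto intro!: finite_PiE)
  show "inj_on Poly_Mapping.lookup {\<alpha> :: 'n \<Rightarrow>\<^sub>0 nat. \<forall>i. Poly_Mapping.lookup \<alpha> i \<le> c}"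
    by (auto intro!: inj_onI poly_mapping_eqI)
qed

lemma lookup_Abs_finite: "Poly_Mapping.lookup (Abs_poly_mapping v) = v"
  for v :: "'n::finite \<Rightarrow> nat"
  by (simp add: Abs_poly_mapping_inverse)

text \<open>Start from \<open>l\<close> and repeatedly raise by one a coordinate that is still below
  \<open>u\<close>; one exists as long as the sum is smaller than that of \<open>u\<close>.\<close>

lemma exists_interpolating_vector:
  fixes l u :: "'n::finite \<Rightarrow> nat"
  assumes le: "\<And>i. l i \<le> u i" and s: "(\<Sum>i\<in>UNIV. l i) \<le> s" "s \<le> (\<Sum>i\<in>UNIV. u i)"
  obtains \<alpha> where "\<And>i. l i \<le> Poly_Mapping.lookup \<alpha> i" "\<And>i. Poly_Mapping.lookup \<alpha> i \<le> u i"
    "(\<Sum>i\<in>UNIV. Poly_Mapping.lookup \<alpha> i) = s"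
proof -
  have "\<exists>v. (\<forall>i. l i \<le> v i \<and> v i \<le> u i) \<and> (\<Sum>i\<in>UNIV. v i) = s"
    using s
  proof (induction s rule: dec_induct)
    case base
    then show ?case using le by (intro exI[of _ l]) auto
  next
    case (step n)
    then obtain v where v: "\<And>i. l i \<le> v i \<and> v i \<le> u i" "(\<Sum>i\<in>UNIV. v i) = n" by auto
    have "\<exists>j. v j < u j"
    proof (rule ccontr)
      assume "\<nexists>j. v j < u j"
      then have "sum u UNIV \<le> sum v UNIV" by (intro sum_mono) (simp add: not_less)
      then show False using step.prems v(2) by simp
    qed
    then obtain j where j: "v j < u j" ..
    have "(\<Sum>i\<in>UNIV. (v(j := Suc (v j))) i) = Suc (v j) + (\<Sum>i\<in>UNIV - {j}. (v(j := Suc (v j))) i)"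
      by (simp add: sum.remove[of UNIV j])
    also have "(\<Sum>i\<in>UNIV - {j}. (v(j := Suc (v j))) i) = (\<Sum>i\<in>UNIV - {j}. v i)"
      by (rule sum.cong) auto
    also have "Suc (v j) + (\<Sum>i\<in>UNIV - {j}. v i) = Suc n"
      using v(2) by (simp add: sum.remove[of UNIV j])
    finally show ?case
      using v(1) j by (intro exI[of _ "v(j := Suc (v j))"]) (auto intro: le_SucI)
  qed
  then obtain v where "\<forall>i. l i \<le> v i \<and> v i \<le> u i" "(\<Sum>i\<in>UNIV. v i) = s" by blast
  then show ?thesis using that[of "Abs_poly_mapping v"] by (simp add: lookup_Abs_finite)
qed

section \<open>Exponent vectors of the generators\<close>

definition vexps :: "nat \<Rightarrow> nat \<Rightarrow> ('n::finite \<Rightarrow>\<^sub>0 nat) set"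
  where "vexps d c = {\<alpha>. (\<Sum>i\<in>UNIV. Poly_Mapping.lookup \<alpha> i) = d \<and> (\<forall>i. Poly_Mapping.lookup \<alpha> i \<le> c)}"

lemma sum_lookup_add:
  "(\<Sum>i\<in>UNIV. Poly_Mapping.lookup (\<alpha> + \<beta>) i) =
    (\<Sum>i\<in>UNIV. Poly_Mapping.lookup \<alpha> i) + (\<Sum>i\<in>UNIV. Poly_Mapping.lookup (\<beta> :: 'n::finite \<Rightarrow>\<^sub>0 nat) i)"
  by (simp add: lookup_add sum.distrib)

lemma sum_lookup_single:
  "(\<Sum>i\<in>UNIV. Poly_Mapping.lookup (Poly_Mapping.single (j :: 'n::finite) k) i) = (k :: nat)"
  by (simp add: lookup_single when_def)

lemma sum_lookup_eq_0_iff: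
  "(\<Sum>i\<in>UNIV. Poly_Mapping.lookup \<alpha> i) = 0 \<longleftrightarrow> (\<alpha> :: 'n::finite \<Rightarrow>\<^sub>0 nat) = 0"
  by (auto intro: poly_mapping_eqI)

lemma sum_lookup_eq_1:
  assumes "(\<Sum>i\<in>UNIV. Poly_Mapping.lookup (\<alpha> :: 'n::finite \<Rightarrow>\<^sub>0 nat) i) = 1"
  shows "\<exists>i. \<alpha> = Poly_Mapping.single i 1"
proof -
  have "\<alpha> \<noteq> 0" using assms by auto
  then obtain i where "i \<in> Poly_Mapping.keys \<alpha>" by (metis all_not_in_conv keys_eq_empty)
  then obtain \<beta> where \<beta>: "\<alpha> = Poly_Mapping.single i 1 + \<beta>" by (rule split_off_key)
  have "(\<Sum>i\<in>UNIV. Poly_Mapping.lookup \<beta> i) = 0"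
    using assms unfolding \<beta> sum_lookup_add sum_lookup_single by simp
  then have "\<beta> = 0" by (simp only: sum_lookup_eq_0_iff)
  then show ?thesis using \<beta> by auto
qed

text \<open>A quotient of two monomials of the same degree has degree 0. This gives the minimality
  of the generators.\<close>

lemma vexps_antichain: "\<alpha> \<in> vexps d c \<Longrightarrow> \<gamma> + \<beta> = \<alpha> \<Longrightarrow> \<beta> \<in> vexps d c \<Longrightarrow> \<alpha> = \<beta>"
proof -
  assume "\<alpha> \<in> vexps d c" "\<gamma> + \<beta> = \<alpha>" "\<beta> \<in> vexps d c"
  then have "(\<Sum>i\<in>UNIV. Poly_Mapping.lookup \<gamma> i) = 0"
    using sum_lookup_add[of \<gamma> \<beta>] by (simp add: vexps_def)
  then have "\<gamma> = 0" by (simp only: sum_lookup_eq_0_iff)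
  then show "\<alpha> = \<beta>" using \<open>\<gamma> + \<beta> = \<alpha>\<close> by simp
qed

text \<open>Every generator divides (x_1 ... x_n)^c, with a cofactor of degree n c - d. This
  cofactor has degree at most 1 in the upper range of d.\<close>

lemma vexps_add_complement:
  fixes \<alpha> :: "'n::finite \<Rightarrow>\<^sub>0 nat"
  assumes "\<alpha> \<in> vexps d c"
  obtains \<beta> where "\<alpha> + \<beta> = Abs_poly_mapping (\<lambda>_. c)"
    "d + (\<Sum>i\<in>UNIV. Poly_Mapping.lookup \<beta> i) = CARD('n) * c"
proof
  let ?\<beta> = "Abs_poly_mapping (\<lambda>_. c) - \<alpha>"
  show 1: "\<alpha> + ?\<beta> = Abs_poly_mapping (\<lambda>_. c)"
    using assms by (intro poly_mapping_eqI)
      (auto simp: vexps_def lookup_add lookup_minus lookup_Abs_finite)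
  have "(\<Sum>i\<in>UNIV. Poly_Mapping.lookup (\<alpha> + ?\<beta>) i) = CARD('n) * c"
    unfolding 1 by (simp add: lookup_Abs_finite)
  then show "d + (\<Sum>i\<in>UNIV. Poly_Mapping.lookup ?\<beta> i) = CARD('n) * c"
    using assms unfolding sum_lookup_add by (simp add: vexps_def)
qed

section \<open>Quadratic relations in the middle range of degrees\<close>

text \<open>All four monomials share a factor of degree d - 2 that leaves room below the bound c for
  the two variables still to be multiplied in.\<close>

lemma vexps_quadratic_relation:
  assumes n: "CARD('n::finite) \<noteq> 1" and d: "2 \<le> d" "d + 2 \<le> CARD('n::finite) * c"
  obtains \<alpha> \<beta> \<gamma> \<delta> :: "'n::finite \<Rightarrow>\<^sub>0 nat" where
    "\<alpha> \<in> vexps d c" "\<beta> \<in> vexps d c" "\<gamma> \<in> vexps d c" "\<delta> \<in> vexps d c"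
    "\<alpha> + \<beta> = \<gamma> + \<delta>" "\<alpha> \<noteq> \<gamma>" "\<alpha> \<noteq> \<delta>"
proof -
  let ?e = "\<lambda>i :: 'n. Poly_Mapping.single i (1::nat)"
  \<comment> \<open>The shared factor stays \<open>r\<close> below the bound on \<open>A\<close>. In
    both uses, 2 variables with room 2 and 4 variables with room 1, this costs 4 in total, and d - 2
    <= n c - 4 is the hypothesis on d.\<close>
  have base: "\<exists>\<gamma> :: 'n \<Rightarrow>\<^sub>0 nat. (\<Sum>i\<in>UNIV. Poly_Mapping.lookup \<gamma> i) = d - 2 \<and>
      (\<forall>i. Poly_Mapping.lookup \<gamma> i \<le> (if i \<in> A then c - r else c))"
    if "card A * r = 4" "r \<le> c" for A :: "'n set" and r
  proof -
    have "(\<Sum>i\<in>UNIV. if i \<in> A then c - r else c) = card A * (c - r) + card (- A) * c"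
      by (simp add: sum.If_cases)
    also have "\<dots> + 4 = (card A + card (- A)) * c"
    proof -
      obtain k where "c = r + k" using \<open>r \<le> c\<close> le_Suc_ex by blast
      then show ?thesis unfolding that(1)[symmetric] by (simp add: algebra_simps)
    qed
    also have "card A + card (- A) = CARD('n)"
      using card_Un_disjoint[of A "- A"] by (simp add: Compl_partition)
    finally have "d - 2 \<le> (\<Sum>i\<in>UNIV. if i \<in> A then c - r else c)" using d by linarith
    then obtain \<gamma> :: "'n \<Rightarrow>\<^sub>0 nat" where
      "\<And>i. Poly_Mapping.lookup \<gamma> i \<le> (if i \<in> A then c - r else c)"
      "(\<Sum>i\<in>UNIV. Poly_Mapping.lookup \<gamma> i) = d - 2"
      by (rule exists_interpolating_vector[of "\<lambda>_. 0", rotated 2]) auto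
    then show ?thesis by blast
  qed
  have "c \<noteq> 0" using d by (cases c) auto
  then consider "c \<ge> 2" | "c = 1" by linarith
  then show ?thesis
  proof cases
    case 1
    have "CARD('n) \<ge> 2" using n zero_less_card_finite[where 'a = 'n] by linarith
    then obtain A :: "'n set" where A: "card A = 2" using obtain_subset_with_card_n by metis
    then obtain i j where ij: "A = {i, j}" "i \<noteq> j" by (auto simp: card_2_iff)
    obtain \<gamma> :: "'n \<Rightarrow>\<^sub>0 nat" where \<gamma>: "(\<Sum>i\<in>UNIV. Poly_Mapping.lookup \<gamma> i) = d - 2"
      "\<And>l. Poly_Mapping.lookup \<gamma> l \<le> (if l \<in> A then c - 2 else c)"
      using base[of A 2] A 1 by auto
    have in_vexps: "\<gamma> + (?e k + ?e l) \<in> vexps d c" if "k \<in> A" "l \<in> A" for k l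
      unfolding vexps_def
    proof (intro CollectI conjI allI)
      show "(\<Sum>h\<in>UNIV. Poly_Mapping.lookup (\<gamma> + (?e k + ?e l)) h) = d"
        unfolding sum_lookup_add sum_lookup_single \<gamma>(1) using d(1) by simp
      show "Poly_Mapping.lookup (\<gamma> + (?e k + ?e l)) h \<le> c" for h
        using \<gamma>(2)[of h] that 1 by (auto simp: lookup_add lookup_single when_def split: if_splits)
    qed
    have "Poly_Mapping.lookup (\<gamma> + (?e i + ?e i)) i \<noteq> Poly_Mapping.lookup (\<gamma> + (?e i + ?e j)) i"
      using ij by (simp add: lookup_add lookup_single)
    \<comment> \<open>The right-hand side of the relation is a square, so this one inequality covers
      both required ones.\<close>
    then have "\<gamma> + (?e i + ?e i) \<noteq> \<gamma> + (?e i + ?e j)" by metis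
    show ?thesis
    proof (rule that)
      show "\<gamma> + (?e i + ?e i) \<in> vexps d c" "\<gamma> + (?e j + ?e j) \<in> vexps d c"
        "\<gamma> + (?e i + ?e j) \<in> vexps d c" "\<gamma> + (?e i + ?e j) \<in> vexps d c"
        by (rule in_vexps; simp add: ij)+
      show "\<gamma> + (?e i + ?e i) + (\<gamma> + (?e j + ?e j)) = \<gamma> + (?e i + ?e j) + (\<gamma> + (?e i + ?e j))"
        by (simp only: ac_simps)
    qed fact+
  next
    case 2
    \<comment> \<open>For c = 1 the bounds read 2 <= d <= n - 2.\<close>
    have "CARD('n) \<ge> 4" using d 2 by simp
    then obtain A :: "'n set" where A: "card A = 4" using obtain_subset_with_card_n by metis
    then have "card A = Suc 3" by simp
    then obtain i B where B: "A = insert i B" "i \<notin> B" "card B = 3" using card_Suc_eq[of A 3] by blast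
    then obtain j k l where "B = {j, k, l}" "j \<noteq> k" "j \<noteq> l" "k \<noteq> l" by (auto simp: card_3_iff)
    then have ij: "A = {i, j, k, l}" "distinct [i, j, k, l]" using B by auto
    obtain \<gamma> :: "'n \<Rightarrow>\<^sub>0 nat" where \<gamma>: "(\<Sum>i\<in>UNIV. Poly_Mapping.lookup \<gamma> i) = d - 2"
      "\<And>l. Poly_Mapping.lookup \<gamma> l \<le> (if l \<in> A then c - 1 else c)"
      using base[of A 1] A 2 by auto
    have in_vexps: "\<gamma> + (?e p + ?e q) \<in> vexps d c" if "p \<in> A" "q \<in> A" "p \<noteq> q" for p q
      unfolding vexps_def
    proof (intro CollectI conjI allI)
      show "(\<Sum>h\<in>UNIV. Poly_Mapping.lookup (\<gamma> + (?e p + ?e q)) h) = d"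
        unfolding sum_lookup_add sum_lookup_single \<gamma>(1) using d(1) by simp
      show "Poly_Mapping.lookup (\<gamma> + (?e p + ?e q)) h \<le> c" for h
        using \<gamma>(2)[of h] that 2 by (auto simp: lookup_add lookup_single when_def split: if_splits)
    qed
    have "Poly_Mapping.lookup (\<gamma> + (?e i + ?e j)) j \<noteq> Poly_Mapping.lookup (\<gamma> + (?e i + ?e k)) j"
      using ij by (auto simp: lookup_add lookup_single when_def)
    moreover have "Poly_Mapping.lookup (\<gamma> + (?e i + ?e j)) i \<noteq> Poly_Mapping.lookup (\<gamma> + (?e j + ?e l)) i"
      using ij by (auto simp: lookup_add lookup_single when_def)
    ultimately have "\<gamma> + (?e i + ?e j) \<noteq> \<gamma> + (?e i + ?e k)" "\<gamma> + (?e i + ?e j) \<noteq> \<gamma> + (?e j + ?e l)"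
      by metis+
    show ?thesis
    proof (rule that)
      show "\<gamma> + (?e i + ?e j) \<in> vexps d c" "\<gamma> + (?e k + ?e l) \<in> vexps d c"
        "\<gamma> + (?e i + ?e k) \<in> vexps d c" "\<gamma> + (?e j + ?e l) \<in> vexps d c"
        by (rule in_vexps; use ij in simp)+
      show "\<gamma> + (?e i + ?e j) + (\<gamma> + (?e k + ?e l)) = \<gamma> + (?e i + ?e k) + (\<gamma> + (?e j + ?e l))"
        by (simp only: ac_simps)
    qed fact+
  qed
qed

section \<open>Exchange for variables and for their complements\<close>

text \<open>Compare exponents of the variable f_j = x_(u j): it divides the image of y^b' but not
  that of y^b, so it divides x^a. Hence f_j divides x^a f_i for any \<open>i\<close>.\<close>

lemma exchange_variables:
  fixes e :: "nat \<Rightarrow> 'n \<Rightarrow>\<^sub>0 nat"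
  assumes e: "\<And>l. l < m \<Longrightarrow> e l = Poly_Mapping.single (u l) 1" and inj: "inj_on u {..<m}"
    and b: "Poly_Mapping.keys b \<subseteq> {..<m}" "Poly_Mapping.keys b' \<subseteq> {..<m}"
    and disj: "Poly_Mapping.keys b \<inter> Poly_Mapping.keys b' = {}"
    and eq: "a + weight e b = a' + weight e b'"
    and j: "j \<in> Poly_Mapping.keys b'"
  shows "\<exists>a''. a + e i = a'' + e j"
proof -
  have jm: "j < m" using b j by auto
  have w: "Poly_Mapping.lookup (weight e x) (u j) = Poly_Mapping.lookup x j"
    if "Poly_Mapping.keys x \<subseteq> {..<m}" for x
  proof -
    have "weight (\<lambda>l. Poly_Mapping.lookup (e l) (u j)) x = weight (\<lambda>l. if u l = u j then 1 else 0) x"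
      unfolding weight_nat using that
      by (intro sum.cong) (auto simp: e lookup_single when_def dest: subsetD)
    also have "\<dots> = Poly_Mapping.lookup x j" using inj that jm by (intro weight_delta) auto
    finally show ?thesis by (simp add: lookup_weight)
  qed
  have "Poly_Mapping.lookup (a + weight e b) (u j) = Poly_Mapping.lookup (a' + weight e b') (u j)"
    by (simp only: eq)
  moreover have "Poly_Mapping.lookup b j = 0" "Poly_Mapping.lookup b' j > 0"
    using disj j by (auto simp: in_keys_iff)
  ultimately have "u j \<in> Poly_Mapping.keys a"
    using b by (simp add: lookup_add w in_keys_iff)
  then obtain a0 where "a = Poly_Mapping.single (u j) 1 + a0" by (rule split_off_key)
  then have "a + e i = (a0 + e i) + e j" using e[OF jm] by (simp add: ac_simps)
  then show ?thesis ..
qed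

text \<open>Here f_l = x^C / x_(u l). In equal degrees, the image of y^b has a smaller exponent at
  x_(u i) than that of y^b', so x_(u i) divides x^a. Then x^a f_i is a multiple of x^C and thus of
  every f_j.\<close>

lemma exchange_complements:
  fixes e :: "nat \<Rightarrow> 'n \<Rightarrow>\<^sub>0 nat"
  assumes e: "\<And>l. l < m \<Longrightarrow> e l + Poly_Mapping.single (u l) 1 = C" and inj: "inj_on u {..<m}"
    and b: "Poly_Mapping.keys b \<subseteq> {..<m}" "Poly_Mapping.keys b' \<subseteq> {..<m}"
    and disj: "Poly_Mapping.keys b \<inter> Poly_Mapping.keys b' = {}"
    and deg: "weight (\<lambda>_. 1::nat) b = weight (\<lambda>_. 1) b'"
    and eq: "a + weight e b = a' + weight e b'"
    and i: "i \<in> Poly_Mapping.keys b" and jm: "j < m"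
  shows "\<exists>a''. a + e i = a'' + e j"
proof -
  have im: "i < m" using b i by auto
  \<comment> \<open>Each of the factors contributes the exponent of x^C, except that y_i contributes
    one less. The additive form avoids truncated subtraction.\<close>
  have w: "Poly_Mapping.lookup (weight e x) (u i) + Poly_Mapping.lookup x i =
      weight (\<lambda>_. 1) x * Poly_Mapping.lookup C (u i)"
    if "Poly_Mapping.keys x \<subseteq> {..<m}" for x
  proof -
    have "Poly_Mapping.lookup x i = weight (\<lambda>l. if u l = u i then 1 else 0) x"
      using inj that im by (intro weight_delta[symmetric]) auto
    then have "Poly_Mapping.lookup (weight e x) (u i) + Poly_Mapping.lookup x i =
        weight (\<lambda>l. Poly_Mapping.lookup (e l) (u i) + (if u l = u i then 1 else 0)) x"
      by (simp only: lookup_weight weight_plus)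
    also have "\<dots> = weight (\<lambda>_. Poly_Mapping.lookup C (u i)) x"
      unfolding weight_nat
    proof (rule sum.cong)
      fix l assume "l \<in> Poly_Mapping.keys x"
      then have "l < m" using that by auto
      then show "Poly_Mapping.lookup x l * (Poly_Mapping.lookup (e l) (u i) + (if u l = u i then 1 else 0)) =
          Poly_Mapping.lookup x l * Poly_Mapping.lookup C (u i)"
        by (simp add: e[symmetric] lookup_add lookup_single when_def)
    qed simp
    finally show ?thesis by (subst (asm) weight_const_nat)
  qed
  have "Poly_Mapping.lookup (a + weight e b) (u i) = Poly_Mapping.lookup (a' + weight e b') (u i)"
    by (simp only: eq)
  moreover have "Poly_Mapping.lookup b' i = 0" "Poly_Mapping.lookup b i > 0"
    using disj i by (auto simp: in_keys_iff)
  ultimately have "u i \<in> Poly_Mapping.keys a"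
    using w[OF b(1)] w[OF b(2)] deg by (simp add: lookup_add in_keys_iff)
  then obtain a0 where a0: "a = Poly_Mapping.single (u i) 1 + a0" by (rule split_off_key)
  have "a + e i = a0 + C" by (simp add: a0 e[OF im, symmetric] ac_simps)
  also have "\<dots> = (a0 + Poly_Mapping.single (u j) 1) + e j"
    by (simp add: e[OF jm, symmetric] ac_simps)
  finally show ?thesis ..
qed

section \<open>The classification\<close>

theorem corollary3p6:
  fixes d c :: nat
  shows "linear_type (bounded_veronese d c :: ('n::finite, 'k::field) mpol set) \<longleftrightarrow>
    CARD('n) = 1 \<or> d \<le> 1 \<or> int d \<ge> int CARD('n) * int c - 1"
proof -
  let ?E = "vexps d c :: ('n \<Rightarrow>\<^sub>0 nat) set"
  have "finite ?E"
    by (rule finite_subset[OF _ finite_bounded_exponents[of c]]) (auto simp: vexps_def)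
  \<comment> \<open>The numbering is injective, so that distinct indices belong to distinct minimal
    generators.\<close>
  then obtain e where bij: "bij_betw e {..<card ?E} ?E"
    using ex_bij_betw_nat_finite by (metis atLeast0LessThan)
  define m where "m = card ?E"
  define f where "f l = (Poly_Mapping.single (e l) 1 :: ('n, 'k) mpol)" for l
  have img: "e ` {..<m} = ?E" and inj: "inj_on e {..<m}"
    using bij by (auto simp: bij_betw_def m_def)
  have eE: "e l \<in> ?E" if "l < m" for l using img that by auto
  have "f ` {..<m} = (\<lambda>\<alpha>. Poly_Mapping.single \<alpha> 1) ` ?E"
    unfolding f_def by (simp add: image_image flip: img)
  then have "ideal_gen UNIV (f ` {..<m}) = (bounded_veronese d c :: ('n, 'k) mpol set)"
    unfolding bounded_veronese_def vexps_def by (simp add: image_Collect)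
  then have iff: "linear_type (bounded_veronese d c :: ('n, 'k) mpol set) \<longleftrightarrow>
      rees_ideal m f = linear_ideal m f"
    by (rule linear_type_iff)
  \<comment> \<open>Used for labelling each generator by a variable that determines it.\<close>
  have inj_label: "inj_on u {..<m}"
    if "\<And>k l. k < m \<Longrightarrow> l < m \<Longrightarrow> u k = u l \<Longrightarrow> e k = e l" for u :: "nat \<Rightarrow> 'n"
  proof (rule inj_onI)
    fix k l assume "k \<in> {..<m}" "l \<in> {..<m}" "u k = u l"
    moreover from this have "e k = e l" using that by blast
    ultimately show "k = l" using inj by (blast dest: inj_onD)
  qed
  \<comment> \<open>With at most one generator, two nonconstant monomials in y always share a
    variable, so the exchange condition is vacuous. The zero ideal is included.\<close>
  have trivial: "rees_ideal m f = linear_ideal m f" if "\<And>\<alpha> \<beta>. \<alpha> \<in> ?E \<Longrightarrow> \<beta> \<in> ?E \<Longrightarrow> \<alpha> = \<beta>"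
  proof -
    have one: "i = j" if "i < m" "j < m" for i j
      using \<open>\<And>\<alpha> \<beta>. \<alpha> \<in> ?E \<Longrightarrow> \<beta> \<in> ?E \<Longrightarrow> \<alpha> = \<beta>\<close>[OF eE[OF that(1)] eE[OF that(2)]] that
      by (intro inj_onD[OF inj]) auto
    show ?thesis
      unfolding f_def
    proof (rule linear_type_monomialI)
      fix b b' :: "nat \<Rightarrow>\<^sub>0 nat"
      assume b: "Poly_Mapping.keys b \<subseteq> {..<m}" "Poly_Mapping.keys b' \<subseteq> {..<m}" "b \<noteq> 0" "b' \<noteq> 0"
        "Poly_Mapping.keys b \<inter> Poly_Mapping.keys b' = {}"
      obtain i j where ij: "i \<in> Poly_Mapping.keys b" "j \<in> Poly_Mapping.keys b'"
        using b(3,4) by (metis all_not_in_conv keys_eq_empty)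
      then have "i = j" using b(1,2) by (intro one) auto
      then have False using ij b(5) by auto
      then show "\<exists>i\<in>Poly_Mapping.keys b. \<exists>j\<in>Poly_Mapping.keys b'. \<exists>a''. a + e i = a'' + e j" for a ..
    qed
  qed
  show ?thesis
    unfolding iff
  proof
    assume "CARD('n) = 1 \<or> d \<le> 1 \<or> int d \<ge> int CARD('n) * int c - 1"
    then consider "CARD('n) = 1" | "d = 0" | "d \<ge> CARD('n) * c" | "d = 1" | "Suc d = CARD('n) * c"
      by (fastforce simp flip: of_nat_mult)
    then show "rees_ideal m f = linear_ideal m f"
    proof cases
      case 1
      \<comment> \<open>In one variable the degree determines the monomial.\<close>
      then obtain x :: 'n where x: "UNIV = {x}" by (auto simp: card_1_singleton_iff)
      show ?thesis
      proof (intro trivial poly_mapping_eqI)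
        fix \<alpha> \<beta> :: "'n \<Rightarrow>\<^sub>0 nat" and v assume "\<alpha> \<in> ?E" "\<beta> \<in> ?E"
        moreover have "v = x" using x by auto
        ultimately show "Poly_Mapping.lookup \<alpha> v = Poly_Mapping.lookup \<beta> v"
          by (simp add: vexps_def x)
      qed
    next
      case 2
      then show ?thesis by (intro trivial) (auto simp: vexps_def intro!: poly_mapping_eqI)
    next
      case 3
      \<comment> \<open>The cofactor in (x_1 ... x_n)^c has degree 0, so this power is the only
        possible generator; for d > n c there is none.\<close>
      have E_eq: "\<alpha> = Abs_poly_mapping (\<lambda>_. c)" if \<alpha>: "\<alpha> \<in> ?E" for \<alpha>
      proof -
        obtain \<beta> where \<beta>: "\<alpha> + \<beta> = Abs_poly_mapping (\<lambda>_. c)"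
          "d + (\<Sum>i\<in>UNIV. Poly_Mapping.lookup \<beta> i) = CARD('n) * c"
          using \<alpha> by (rule vexps_add_complement)
        have "(\<Sum>i\<in>UNIV. Poly_Mapping.lookup \<beta> i) = 0" using \<beta>(2) 3 by linarith
        then have "\<beta> = 0" by (simp only: sum_lookup_eq_0_iff)
        then show ?thesis using \<beta>(1) by simp
      qed
      show ?thesis by (intro trivial) (metis E_eq)
    next
      case 4
      have "\<forall>l. \<exists>i. l < m \<longrightarrow> e l = Poly_Mapping.single i 1"
        using eE 4 sum_lookup_eq_1 by (fastforce simp: vexps_def)
      then obtain u where u: "\<And>l. l < m \<Longrightarrow> e l = Poly_Mapping.single (u l) 1" by metis
      have inj_u: "inj_on u {..<m}" by (rule inj_label) (simp add: u)
      show ?thesis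
        unfolding f_def
      proof (intro linear_type_monomialI)
        fix a a' and b b' :: "nat \<Rightarrow>\<^sub>0 nat"
        assume b: "Poly_Mapping.keys b \<subseteq> {..<m}" "Poly_Mapping.keys b' \<subseteq> {..<m}" "b \<noteq> 0" "b' \<noteq> 0"
          "Poly_Mapping.keys b \<inter> Poly_Mapping.keys b' = {}" "a + weight e b = a' + weight e b'"
        obtain i j where ij: "i \<in> Poly_Mapping.keys b" "j \<in> Poly_Mapping.keys b'"
          using b(3,4) by (metis all_not_in_conv keys_eq_empty)
        have "\<exists>a''. a + e i = a'' + e j"
          using u inj_u b(1,2,5,6) ij(2) by (rule exchange_variables)
        then show "\<exists>i\<in>Poly_Mapping.keys b. \<exists>j\<in>Poly_Mapping.keys b'. \<exists>a''. a + e i = a'' + e j"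
          using ij by blast
      qed
    next
      case 5
      let ?C = "Abs_poly_mapping (\<lambda>_ :: 'n. c)"
      \<comment> \<open>The cofactor has degree n c - d = 1, so it is a variable.\<close>
      have "\<exists>i. e l + Poly_Mapping.single i 1 = ?C" if l: "l < m" for l
      proof -
        obtain \<beta> where \<beta>: "e l + \<beta> = ?C" "d + (\<Sum>i\<in>UNIV. Poly_Mapping.lookup \<beta> i) = CARD('n) * c"
          using eE[OF l] by (rule vexps_add_complement)
        have "(\<Sum>i\<in>UNIV. Poly_Mapping.lookup \<beta> i) = 1" using \<beta>(2) 5 by linarith
        then show ?thesis using \<beta>(1) sum_lookup_eq_1 by metis
      qed
      then obtain u where u: "\<And>l. l < m \<Longrightarrow> e l + Poly_Mapping.single (u l) 1 = ?C" by metis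
      have inj_u: "inj_on u {..<m}" by (rule inj_label) (metis u add_right_cancel)
      show ?thesis
        unfolding f_def
      proof (rule linear_type_monomialI)
        fix a a' and b b' :: "nat \<Rightarrow>\<^sub>0 nat"
        assume b: "Poly_Mapping.keys b \<subseteq> {..<m}" "Poly_Mapping.keys b' \<subseteq> {..<m}" "b \<noteq> 0" "b' \<noteq> 0"
          "Poly_Mapping.keys b \<inter> Poly_Mapping.keys b' = {}"
          "weight (\<lambda>_. 1::nat) b = weight (\<lambda>_. 1) b'" "a + weight e b = a' + weight e b'"
        obtain i j where ij: "i \<in> Poly_Mapping.keys b" "j \<in> Poly_Mapping.keys b'"
          using b(3,4) by (metis all_not_in_conv keys_eq_empty)
        then have "\<exists>a''. a + e i = a'' + e j"
          using b by (intro exchange_complements[OF u inj_u b(1,2,5,6,7)]) auto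
        then show "\<exists>i\<in>Poly_Mapping.keys b. \<exists>j\<in>Poly_Mapping.keys b'. \<exists>a''. a + e i = a'' + e j"
          using ij by blast
      qed
    qed
  next
    assume eq: "rees_ideal m f = linear_ideal m f"
    show "CARD('n) = 1 \<or> d \<le> 1 \<or> int d \<ge> int CARD('n) * int c - 1"
    proof (rule ccontr)
      assume "\<not> ?thesis"
      then have "CARD('n) \<noteq> 1" "2 \<le> d" "d + 2 \<le> CARD('n) * c"
        by (auto simp flip: of_nat_mult)
      then obtain \<alpha> \<beta> \<gamma> \<delta> :: "'n \<Rightarrow>\<^sub>0 nat" where
        E: "\<alpha> \<in> ?E" "\<beta> \<in> ?E" "\<gamma> \<in> ?E" "\<delta> \<in> ?E" and
        rel: "\<alpha> + \<beta> = \<gamma> + \<delta>" "\<alpha> \<noteq> \<gamma>" "\<alpha> \<noteq> \<delta>"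
        by (rule vexps_quadratic_relation)
      obtain p q r s where "p < m" "q < m" "r < m" "s < m"
        and "e p = \<alpha>" "e q = \<beta>" "e r = \<gamma>" "e s = \<delta>"
        using E unfolding img[symmetric] by auto
      \<comment> \<open>Divisibility between generators forces equal exponents, and \<open>e\<close>
        is injective.\<close>
      moreover have "i = j" if "i < m" "j < m" "\<gamma> + e j = e i" for i j \<gamma>
        using vexps_antichain[OF eE that(3) eE] that inj by (auto simp: inj_on_def)
      ultimately have "rees_ideal m f \<noteq> linear_ideal m f"
        unfolding f_def using rel by (intro not_linear_type_monomialI[of m e p q r s]) auto
      then show False using eq by simp
    qed
  qed
qed

end
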